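(* Let $\Omega\subset\mathbb{R}^N$, $N\ge2$, be a bounded domain with $C^{2,\alpha}$ boundary, let $f$ satisfy the standing assumptions (A) and $\lim_{s\to\sigma^+}f''(s)=+\infty$, and let $u$ be the minimizer of $J(v)=\int_\Omega[f(|\nabla v|)-v]\,dx$ over $W^{1,\infty}_0(\Omega)$. Assume there is a sequence $(f_n)$ of convex functions with $f_n(0)=0$, $f_n(s)/s\to\infty$ as $s\to\infty$, satisfying: (i) $f_n\in C^1([0,+\infty))\cap C^3((0,+\infty))$; (ii) $f_n\to f$ uniformly on compact subsets of $[0,+\infty)$; (iii) $f_n'(0)=0$, $f_n'$ decreases in $n$ to $f'$ and $f_n'\to f'$ uniformly on compact subsets of $[0,+\infty)$; (iv) $f_n''>0$ on $(0,+\infty)$; (v) $\lim_{s\to0^+}\frac{sf_n''(s)-f_n'(s)}{s^3}=0$ and $\lim_{s\to0^+}\frac{f_n'(s)}{s}=0$ for each $n$; (vi) $\lim_{n\to\infty}\frac{sf_n''(s)-f_n'(s)}{s^3}=0$ and $\lim_{n\to\infty}\frac{f_n'(s)}{s}=0$ uniformly on compact subsets of $[0,\sigma)$ (extended continuously by $0$ at $s=0$); (vii) $a_n\to a$ uniformly on compact subsets of $(0,+\infty)$ and $b_n\to b$ uniformly on compact subsets of $(\sigma,+\infty)$. Then $u$ is a viscosity solution in $\Omega$ of $$\min\Big(-[1-a(|\nabla u|)]\Delta_\infty u-|\nabla u|^2a(|\nabla u|)\Delta u-b(|\nabla u|),\ |\nabla u|-\sigma\Big)=0.$$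
   Context: Standing assumptions (A) on $f:[0,+\infty)\to\mathbb{R}$: $f$ convex, nondecreasing, and there is $\sigma>0$ with $f\in C^1([0,+\infty))\cap C^3((\sigma,+\infty))$; $f(0)=0$ and $\lim_{s\to+\infty}f(s)/s=+\infty$; $f'(s)=0$ for $0\le s\le\sigma$; $f''(s)>0$ for $s>\sigma$. Define $a(s)=\frac{f'(s)}{sf''(s)}$ and $b(s)=\frac{s^2}{f''(s)}$ for $s>\sigma$, and $a(s)=b(s)=0$ for $0\le s\le\sigma$; and $a_n(s)=\frac{f_n'(s)}{sf_n''(s)}$, $b_n(s)=\frac{s^2}{f_n''(s)}$ for $s>0$. $\Delta_\infty u=\sum_{i,j}\partial_{ij}u\,\partial_iu\,\partial_ju$. Viscosity solutions of $G(\nabla v,D^2v)=0$: an u.s.c. $w$ is a subsolution if for every $x_0\in\Omega$ and $\phi\in C^2(\Omega)$ with $w(x_0)=\phi(x_0)$, $w<\phi$ elsewhere, $G(\nabla\phi(x_0),D^2\phi(x_0))\le0$; an l.s.c. $w$ is a supersolution if for $\phi$ with $w(x_0)=\phi(x_0)$, $w>\phi$ elsewhere, $G(\nabla\phi(x_0),D^2\phi(x_0))\ge0$; a continuous $w$ is a solution if both. *)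

theory Defs
  imports "HOL-Analysis.Analysis"
begin

(* Gradient of v at x (meaningful where v is differentiable; Lipschitz
   functions are differentiable a.e. by Rademacher's theorem). *)
definition grad :: "(real^'n \<Rightarrow> real) \<Rightarrow> real^'n \<Rightarrow> real^'n" where
  "grad v x = (SOME p. (v has_derivative (\<lambda>h. p \<bullet> h)) (at x))"

(* phi is C^2 on the open set U, with gradient Dphi and Hessian D2phi
   (D2phi x $ i $ j = d_j d_i phi (x)). *)
definition C2_on :: "(real^'n) set \<Rightarrow> (real^'n \<Rightarrow> real) \<Rightarrow> (real^'n \<Rightarrow> real^'n)
                      \<Rightarrow> (real^'n \<Rightarrow> real^'n^'n) \<Rightarrow> bool" where
  "C2_on U phi Dphi D2phi \<longleftrightarrow>
     (\<forall>x\<in>U. (phi has_derivative (\<lambda>h. Dphi x \<bullet> h)) (at x)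
          \<and> (Dphi has_derivative (\<lambda>h. D2phi x *v h)) (at x))
     \<and> continuous_on U D2phi"

definition C2alpha_boundary :: "real \<Rightarrow> (real^'n) set \<Rightarrow> bool" where
  "C2alpha_boundary \<alpha> \<Omega> \<longleftrightarrow>
     (\<forall>x0\<in>frontier \<Omega>. \<exists>U \<rho> D\<rho> D2\<rho> C. open U \<and> x0 \<in> U \<and>
        C2_on U \<rho> D\<rho> D2\<rho> \<and>
        (\<forall>x\<in>U. \<forall>y\<in>U. norm (D2\<rho> x - D2\<rho> y) \<le> C * dist x y powr \<alpha>) \<and>
        (\<forall>x\<in>U. D\<rho> x \<noteq> 0) \<and>
        \<Omega> \<inter> U = {x\<in>U. \<rho> x < 0})"

(* W^{1,infinity}_0(Omega) for a bounded domain: (continuous representatives)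
   Lipschitz functions on the closure vanishing on the boundary. *)
definition W1inf0 :: "(real^'n) set \<Rightarrow> (real^'n \<Rightarrow> real) set" where
  "W1inf0 \<Omega> = {v::real^'n \<Rightarrow> real. (\<exists>L::real. lipschitz_on L (closure \<Omega>) v) \<and> (\<forall>x\<in>frontier \<Omega>. v x = 0)}"

definition Jfun :: "(real \<Rightarrow> real) \<Rightarrow> (real^'n) set \<Rightarrow> (real^'n \<Rightarrow> real) \<Rightarrow> real" where
  "Jfun f \<Omega> v = (LINT x:\<Omega>|lebesgue. f (norm (grad v x)) - v x)"

(* a(s) = f'(s)/(s f''(s)) for s > sigma, 0 for s \<le> sigma *)
definition afun :: "real \<Rightarrow> (real \<Rightarrow> real) \<Rightarrow> (real \<Rightarrow> real) \<Rightarrow> real \<Rightarrow> real" where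
  "afun \<sigma> f1 f2 s = (if s \<le> \<sigma> then 0 else f1 s / (s * f2 s))"

(* b(s) = s^2/f''(s) for s > sigma, 0 for s \<le> sigma *)
definition bfun :: "real \<Rightarrow> (real \<Rightarrow> real) \<Rightarrow> real \<Rightarrow> real" where
  "bfun \<sigma> f2 s = (if s \<le> \<sigma> then 0 else s^2 / f2 s)"

definition inf_lap :: "real^'n \<Rightarrow> real^'n^'n \<Rightarrow> real" where
  "inf_lap p X = p \<bullet> (X *v p)"

definition usc_on :: "(real^'n) set \<Rightarrow> (real^'n \<Rightarrow> real) \<Rightarrow> bool" where
  "usc_on \<Omega> w \<longleftrightarrow> (\<forall>x\<in>\<Omega>. \<forall>e>0. \<forall>\<^sub>F y in at x within \<Omega>. w y < w x + e)"

definition lsc_on :: "(real^'n) set \<Rightarrow> (real^'n \<Rightarrow> real) \<Rightarrow> bool" where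
  "lsc_on \<Omega> w \<longleftrightarrow> (\<forall>x\<in>\<Omega>. \<forall>e>0. \<forall>\<^sub>F y in at x within \<Omega>. w y > w x - e)"

definition viscosity_subsolution ::
  "(real^'n) set \<Rightarrow> (real^'n \<Rightarrow> real^'n^'n \<Rightarrow> real) \<Rightarrow> (real^'n \<Rightarrow> real) \<Rightarrow> bool" where
  "viscosity_subsolution \<Omega> G w \<longleftrightarrow>
     usc_on \<Omega> w \<and>
     (\<forall>x0\<in>\<Omega>. \<forall>phi Dphi D2phi. C2_on \<Omega> phi Dphi D2phi \<and> w x0 = phi x0 \<and>
        (\<forall>x\<in>\<Omega>. x \<noteq> x0 \<longrightarrow> w x < phi x) \<longrightarrow> G (Dphi x0) (D2phi x0) \<le> 0)"

definition viscosity_supersolution ::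
  "(real^'n) set \<Rightarrow> (real^'n \<Rightarrow> real^'n^'n \<Rightarrow> real) \<Rightarrow> (real^'n \<Rightarrow> real) \<Rightarrow> bool" where
  "viscosity_supersolution \<Omega> G w \<longleftrightarrow>
     lsc_on \<Omega> w \<and>
     (\<forall>x0\<in>\<Omega>. \<forall>phi Dphi D2phi. C2_on \<Omega> phi Dphi D2phi \<and> w x0 = phi x0 \<and>
        (\<forall>x\<in>\<Omega>. x \<noteq> x0 \<longrightarrow> w x > phi x) \<longrightarrow> G (Dphi x0) (D2phi x0) \<ge> 0)"

definition viscosity_solution ::
  "(real^'n) set \<Rightarrow> (real^'n \<Rightarrow> real^'n^'n \<Rightarrow> real) \<Rightarrow> (real^'n \<Rightarrow> real) \<Rightarrow> bool" where
  "viscosity_solution \<Omega> G w \<longleftrightarrow>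
     continuous_on \<Omega> w \<and> viscosity_subsolution \<Omega> G w \<and> viscosity_supersolution \<Omega> G w"

end

theory Submission
  imports Defs
begin

text \<open>
  The minimizer is tested directly, without passing to minimizers of approximating functionals.
  Suppose \<open>\<phi>\<close> touches u from below at x0 and the equation fails there. Then the flux
  \<open>P = f'(|\<nabla>\<phi>|) \<nabla>\<phi> / |\<nabla>\<phi>|\<close> satisfies \<open>div P \<ge> -c\<close> weakly near x0 for some \<open>c < 1\<close>, and by convexity
  replacing u by \<open>max u (\<phi> + \<delta>)\<close> near x0 changes J by at most
  \<open>\<integral> P \<bullet> \<nabla>\<eta> - \<eta> \<le> (c - 1) \<integral> \<eta> < 0\<close>, where \<open>\<eta> = max 0 (\<phi> + \<delta> - u)\<close>.
  Where \<open>|\<nabla>\<phi>| < \<sigma>\<close> one has \<open>P = 0\<close>. If \<open>|\<nabla>\<phi>(x0)| = \<sigma>\<close>, then P need not be differentiable and is the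
  uniform limit of the fluxes of the f_n, whose divergence is nonnegative near x0 because a_n is
  uniformly small there and the infinity Laplacian of \<open>\<phi>\<close> is positive.
  Contact from above is the same statement for -u, which minimizes \<open>\<integral> f(|\<nabla>v|) + v\<close>.

  Integrating \<open>P \<bullet> \<nabla>\<eta>\<close> by parts needs Rademacher's theorem. One-dimensional sections are handled by a
  Vitali covering argument; a point where all partial derivatives exist but the function is not
  differentiable lies in a countable union of porous sets.
\<close>

text \<open>The equation enters through one identity: for |p| > \<sigma> the divergence of the flux
  equals f''(|p|)/|p|^2 times minus the first argument of the minimum, minus 1. The term b = s^2/f''
  is what becomes the constant 1, so a failure of the equation is a strict bound on div P, and
  continuity carries it to a small ball. The energies of u and of the competitor are compared
  pointwise almost everywhere with the flux of the test function, never of u, so Lipschitz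
  regularity of u is enough. The obstacle is |p| = \<sigma>: f'' blows up there, and the factor
  f_n''/s^2 in front of the approximate operator is not controlled in n. Only the sign of the
  divergence can be secured, and c = 0 < 1 makes the sign sufficient. The blow-up of f'' enters as
  continuity of a at \<sigma> with value 0, so that the infinity Laplacian dominates the term with
  the Laplacian. Contact from above meets only |p| > \<sigma>, since otherwise the minimum is
  already at most 0.\<close>

section \<open>Difference quotients of Lipschitz functions\<close>

text \<open>Vitali picks countably many disjoint admissible balls inside \<open>U\<close> that cover
  \<open>E\<close> up to a Lebesgue null set, which \<open>M\<close> ignores; the comparison is then
  summed. The balls need only contain \<open>x\<close>, not be centred there: in one dimension they
  will be intervals with \<open>x\<close> as an endpoint.\<close>

lemma Vitali_measure_le:
  fixes E U :: "'a::euclidean_space set"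
  assumes sets: "sets M = sets borel" "sets N = sets borel"
    and null: "\<And>S. S \<in> sets borel \<Longrightarrow> negligible S \<Longrightarrow> emeasure M S = 0"
    and E: "E \<in> sets borel" "open U" "E \<subseteq> U"
    and cov: "\<And>x d. x \<in> E \<Longrightarrow> 0 < d \<Longrightarrow>
      \<exists>a r. 0 < r \<and> r < d \<and> x \<in> cball a r \<and> emeasure M (cball a r) \<le> emeasure N (cball a r)"
  shows "emeasure M E \<le> emeasure N U"
proof -
  define K where "K = {i. 0 < snd i \<and> cball (fst i) (snd i) \<subseteq> U \<and>
    emeasure M (cball (fst i) (snd i)) \<le> emeasure N (cball (fst i) (snd i))}"
  let ?B = "\<lambda>i::'a \<times> real. cball (fst i) (snd i)"
  have K: "\<exists>i. i \<in> K \<and> x \<in> ?B i \<and> snd i < d" if x: "x \<in> E" and d: "0 < d" for x d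
  proof -
    obtain e where e: "e > 0" "ball x e \<subseteq> U"
      using E x by (meson open_contains_ball subsetD)
    \<comment> \<open>A ball of radius below \<open>e/2\<close> that contains \<open>x\<close> lies
      in \<open>ball x e\<close>, hence in \<open>U\<close>.\<close>
    obtain a r where ar: "0 < r" "r < min d (e/2)" "x \<in> cball a r"
      "emeasure M (cball a r) \<le> emeasure N (cball a r)"
      using cov[OF x, of "min d (e/2)"] d e by auto
    have "cball a r \<subseteq> ball x e"
    proof
      fix y assume "y \<in> cball a r"
      then have "dist x y \<le> r + r"
        using ar(3) dist_triangle[of x y a] by (auto simp: dist_commute)
      then show "y \<in> ball x e" using ar(2) by auto
    qed
    then have "(a, r) \<in> K" using ar e by (auto simp: K_def)
    then show ?thesis using ar by force
  qed
  have K0: "0 < snd i" if "i \<in> K" for i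
    using that by (simp add: K_def)
  obtain C where C: "countable C" "C \<subseteq> K"
    "pairwise (\<lambda>i j. disjnt (?B i) (?B j)) C" "negligible (E - (\<Union>i\<in>C. ?B i))"
    by (rule Vitali_covering_theorem_cballs[of K snd E fst, OF K0 K])
  have disj: "disjoint_family_on ?B C"
    using C(3) by (auto simp: disjoint_family_on_def pairwise_def disjnt_def)
  have UB: "(\<Union>i\<in>C. ?B i) \<in> sets borel"
    using C(1) by (intro sets.countable_UN') auto
  have "emeasure M E \<le> emeasure M ((E - (\<Union>i\<in>C. ?B i)) \<union> (\<Union>i\<in>C. ?B i))"
    using E UB by (intro emeasure_mono) (auto simp: sets)
  also have "\<dots> \<le> emeasure M (E - (\<Union>i\<in>C. ?B i)) + emeasure M (\<Union>i\<in>C. ?B i)"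
    using E UB by (intro emeasure_subadditive) (auto simp: sets)
  also have "emeasure M (E - (\<Union>i\<in>C. ?B i)) = 0"
    using null C(4) E UB by auto
  also have "emeasure M (\<Union>i\<in>C. ?B i) = (\<integral>\<^sup>+i. emeasure M (?B i) \<partial>count_space C)"
    using C(1) disj by (intro emeasure_UN_countable) (auto simp: sets)
  also have "\<dots> \<le> (\<integral>\<^sup>+i. emeasure N (?B i) \<partial>count_space C)"
    using C(2) by (intro nn_integral_mono) (auto simp: K_def)
  also have "\<dots> = emeasure N (\<Union>i\<in>C. ?B i)"
    using C(1) disj by (intro emeasure_UN_countable[symmetric]) (auto simp: sets)
  also have "\<dots> \<le> emeasure N U"
    using C(2) E by (intro emeasure_mono) (auto simp: sets K_def)
  finally show ?thesis by simp
qed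

lemma lborel_outer_open:
  fixes S :: "'a::euclidean_space set"
  assumes "S \<in> sets borel" "e > 0"
  shows "\<exists>U. open U \<and> S \<subseteq> U \<and> emeasure lborel U \<le> emeasure lborel S + ennreal e"
proof -
  obtain T where T: "open T" "S \<subseteq> T" "T - S \<in> lmeasurable" "emeasure lebesgue (T - S) < ennreal e"
    using sets_lebesgue_outer_open[of S e] assms by auto
  have "emeasure lborel T = emeasure lborel (S \<union> (T - S))" using T(2) by (simp add: Un_absorb1)
  also have "\<dots> \<le> emeasure lborel S + emeasure lborel (T - S)"
    using assms T by (intro emeasure_subadditive) auto
  also have "\<dots> \<le> emeasure lborel S + ennreal e"
    using T(1,4) assms by (intro add_left_mono) auto
  finally show ?thesis using T by auto
qed

section \<open>One-dimensional sections and directional derivatives\<close>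

text \<open>Built so that a bounded difference quotient without a limit puts the point into such a
  set for some rational \<alpha> < \<beta>; countably many of these sets then cover all bad
  points.\<close>

definition gap_set :: "('a::real_normed_vector \<Rightarrow> real) \<Rightarrow> 'a \<Rightarrow> real \<Rightarrow> real \<Rightarrow> 'a set" where
  "gap_set u e \<alpha> \<beta> = {x. \<forall>d>0.
     (\<exists>h. 0 < \<bar>h\<bar> \<and> \<bar>h\<bar> < d \<and> (u (x + h *\<^sub>R e) - u x) / h < \<alpha>) \<and>
     (\<exists>h. 0 < \<bar>h\<bar> \<and> \<bar>h\<bar> < d \<and> \<beta> < (u (x + h *\<^sub>R e) - u x) / h)}"

text \<open>A G-delta set: for fixed \<open>d\<close> each condition is a union of open sets over
  all admissible \<open>h\<close>, and monotonicity in \<open>d\<close> lets \<open>d\<close> run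
  through 1/(n+1) only.\<close>

lemma gap_set_borel:
  fixes u :: "'a::euclidean_space \<Rightarrow> real"
  assumes u: "continuous_on UNIV u"
  shows "gap_set u e \<alpha> \<beta> \<in> sets borel"
proof -
  define q where "q h x = (u (x + h *\<^sub>R e) - u x) / h" for h x
  have q: "continuous_on UNIV (q h)" for h
    unfolding q_def divide_inverse
    by (intro continuous_intros continuous_on_compose2[OF u]) auto
  define A where "A d = (\<Union>h\<in>{h. 0 < \<bar>h\<bar> \<and> \<bar>h\<bar> < d}. {x. q h x < \<alpha>})" for d
  define B where "B d = (\<Union>h\<in>{h. 0 < \<bar>h\<bar> \<and> \<bar>h\<bar> < d}. {x. \<beta> < q h x})" for d
  have op: "open (A d)" "open (B d)" for d
    unfolding A_def B_def using q
    by (auto intro!: open_UN open_Collect_less continuous_on_const)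
  have mem: "x \<in> A d \<longleftrightarrow> (\<exists>h. 0 < \<bar>h\<bar> \<and> \<bar>h\<bar> < d \<and> q h x < \<alpha>)"
    "x \<in> B d \<longleftrightarrow> (\<exists>h. 0 < \<bar>h\<bar> \<and> \<bar>h\<bar> < d \<and> \<beta> < q h x)" for x d
    by (auto simp: A_def B_def)
  have mono: "A d \<subseteq> A d'" "B d \<subseteq> B d'" if "d \<le> d'" for d d'
    using that by (auto simp: A_def B_def intro: order_less_le_trans)
  have gap: "gap_set u e \<alpha> \<beta> = {x. \<forall>d>0. x \<in> A d \<and> x \<in> B d}"
    unfolding gap_set_def mem q_def ..
  have "gap_set u e \<alpha> \<beta> = (\<Inter>n::nat. A (inverse (Suc n)) \<inter> B (inverse (Suc n)))" (is "_ = ?R")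
  proof (intro equalityI subsetI)
    fix x assume "x \<in> gap_set u e \<alpha> \<beta>"
    then show "x \<in> ?R" by (simp add: gap)
  next
    fix x assume x: "x \<in> ?R"
    have "x \<in> A d \<and> x \<in> B d" if d: "d > 0" for d
    proof -
      obtain n where "inverse (real (Suc n)) < d" using reals_Archimedean d by blast
      moreover have "x \<in> A (inverse (Suc n)) \<inter> B (inverse (Suc n))" using x by blast
      ultimately show ?thesis using mono by (meson IntE less_imp_le subsetD)
    qed
    then show "x \<in> gap_set u e \<alpha> \<beta>" by (simp add: gap)
  qed
  also have "\<dots> \<in> sets borel" using op by auto
  finally show ?thesis .
qed

text \<open>If \<alpha> <= 0 the set is empty, because the quotients are at least \<open>m\<close>.
  Otherwise the measure of the image under \<open>g\<close> is compared with Lebesgue measure by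
  Vitali coverings with the intervals between \<open>t\<close> and \<open>t + h\<close>: quotients
  below \<alpha> and quotients above \<beta> give density bounds that are compatible only on a null
  set. The two-sided slope bound makes \<open>g\<close> a bi-Lipschitz bijection, so the image
  measure is a distribution under the inverse and null sets stay null.\<close>

lemma gap_set_bilipschitz_negligible:
  fixes g :: "real \<Rightarrow> real"
  assumes m: "0 < m"
    and lo: "\<And>x y. x \<le> y \<Longrightarrow> m * (y - x) \<le> g y - g x"
    and up: "\<And>x y. x \<le> y \<Longrightarrow> g y - g x \<le> L * (y - x)"
    and ab: "\<alpha> < \<beta>"
  shows "negligible (gap_set g 1 \<alpha> \<beta>)"
proof (cases "\<alpha> \<le> 0")
  case True
  have "(g (t + h) - g t) / h \<ge> 0" if "h \<noteq> 0" for t h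
  proof (cases "h > 0")
    case True
    have "0 \<le> m * h" using True m by simp
    also have "\<dots> \<le> g (t + h) - g t" using lo[of t "t + h"] True by simp
    finally show ?thesis using True by simp
  next
    case False
    have "0 \<le> m * (-h)" using False m by (simp add: mult_nonneg_nonpos)
    also have "\<dots> \<le> g t - g (t + h)" using lo[of "t + h" t] False by simp
    finally show ?thesis using False that by (simp add: divide_nonpos_neg)
  qed
  then have nless: "\<not> (g (t + h) - g t) / h < \<alpha>" if "0 < \<bar>h\<bar>" for t h
    using True that by (metis abs_zero less_irrefl not_less order_trans)
  have "t \<notin> gap_set g 1 \<alpha> \<beta>" for t
  proof
    assume "t \<in> gap_set g 1 \<alpha> \<beta>"
    then obtain h where "0 < \<bar>h\<bar>" "(g (t + h *\<^sub>R 1) - g t) / h < \<alpha>"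
      unfolding gap_set_def mem_Collect_eq by (meson zero_less_one)
    then show False using nless[of h t] by simp
  qed
  then have "gap_set g 1 \<alpha> \<beta> = {}" by blast
  then show ?thesis by simp
next
  case False
  then have a0: "0 < \<alpha>" and b0: "0 < \<beta>" using ab by auto
  have smono: "g x < g y" if "x < y" for x y
    using lo[of x y] that m by (smt (verit) mult_pos_pos)
  have inj: "inj g" using smono by (metis linorder_injI order_less_irrefl)
  have Lip: "\<bar>g y - g x\<bar> \<le> L * \<bar>y - x\<bar>" for x y
    using up[of x y] up[of y x] smono[of x y] smono[of y x] by (cases x y rule: linorder_cases) auto
  have L: "L-lipschitz_on UNIV g"
  proof (rule lipschitz_onI)
    show "0 \<le> L" using up[of 0 1] lo[of 0 1] m by auto
  qed (use Lip in \<open>auto simp: dist_real_def\<close>)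
  then have cg: "continuous_on UNIV g" using lipschitz_on_continuous_on by blast
  have surj: "\<exists>x. g x = y" for y
  proof -
    \<comment> \<open>With slopes at least \<open>m\<close>, moving this far from 0 to either side
      brings \<open>g\<close> at least to the level \<open>y\<close>.\<close>
    define k where "k = \<bar>y - g 0\<bar> / m"
    have k: "k \<ge> 0" "m * k = \<bar>y - g 0\<bar>" using m by (auto simp: k_def)
    have "g (-k) \<le> y" using lo[of "-k" 0] k by auto
    moreover have "y \<le> g k" using lo[of 0 k] k by auto
    ultimately show ?thesis
      using IVT'[of g "-k" y k] k(1) continuous_on_subset[OF cg] by auto
  qed
  define k where "k = inv g"
  have gk [simp]: "g (k y) = y" for y using surj[of y] by (auto simp: k_def intro: f_inv_into_f)
  have kg [simp]: "k (g x) = x" for x using inj by (simp add: k_def)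
  have kle: "k y \<le> z \<longleftrightarrow> y \<le> g z" "z \<le> k y \<longleftrightarrow> g z \<le> y" for y z
    using smono[of z "k y"] smono[of "k y" z] by (force simp: not_le[symmetric])+
  have "(1/m)-lipschitz_on UNIV k"
  proof (rule lipschitz_onI)
    fix x y
    have "m * \<bar>k x - k y\<bar> \<le> \<bar>x - y\<bar>"
      using lo[of "k x" "k y"] lo[of "k y" "k x"] by (cases "k x \<le> k y") auto
    then show "dist (k x) (k y) \<le> 1/m * dist x y"
      using m by (simp add: dist_real_def field_simps)
  qed (use m in auto)
  then have ck: "continuous_on UNIV k" using lipschitz_on_continuous_on by blast
  then have km [measurable]: "k \<in> borel_measurable borel" by (rule borel_measurable_continuous_onI)
  \<comment> \<open>The image measure \<open>\<nu> A = |g ` A|\<close> satisfies \<open>\<beta> |E| \<le> \<nu> E \<le> \<alpha> |E|\<close> on bounded parts E of the set.\<close>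
  define \<nu> where "\<nu> = distr lborel borel k"
  have nuA: "emeasure \<nu> A = emeasure lborel (k -` A)" if "A \<in> sets borel" for A
    using that by (simp add: \<nu>_def emeasure_distr)
  have kvim: "k -` A = g ` A" for A using kg gk by (force simp: image_iff)
  have nucb: "emeasure \<nu> (cball a r) = ennreal (g (a + r) - g (a - r))" if "r > 0" for a r
  proof -
    have "k -` cball a r = {g (a - r)..g (a + r)}"
      by (auto simp: cball_eq_atLeastAtMost kle)
    then show ?thesis using smono[of "a - r" "a + r"] that by (simp add: nuA)
  qed
  have lbcb: "emeasure (density lborel (\<lambda>_. ennreal c)) (cball a r) = ennreal (c * (2 * r))"
    if "r > 0" "c > 0" for a r c :: real
    using that by (simp add: emeasure_density_const cball_eq_atLeastAtMost ennreal_mult'')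
  \<comment> \<open>For either sign of \<open>h\<close>, the interval between \<open>t\<close> and
    \<open>t + h\<close> written as a closed ball; its \<open>\<nu>\<close>-measure is the
    difference quotient times its length.\<close>
  have ivl: "0 < \<bar>h\<bar>/2" "t \<in> cball (t + h/2) (\<bar>h\<bar>/2)"
    "g (t + h/2 + \<bar>h\<bar>/2) - g (t + h/2 - \<bar>h\<bar>/2) = (g (t + h) - g t) / h * \<bar>h\<bar>" if "h \<noteq> 0" for t h :: real
  proof -
    have "t + h/2 + \<bar>h\<bar>/2 = (if h > 0 then t + h else t)" "t + h/2 - \<bar>h\<bar>/2 = (if h > 0 then t else t + h)"
      by (auto simp: abs_if field_simps)
    then show "g (t + h/2 + \<bar>h\<bar>/2) - g (t + h/2 - \<bar>h\<bar>/2) = (g (t + h) - g t) / h * \<bar>h\<bar>"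
      using that by (auto simp: abs_if)
  qed (use that in \<open>auto simp: dist_real_def\<close>)
  have null: "emeasure (density lborel (\<lambda>_. ennreal c)) S = 0" "emeasure \<nu> S = 0"
    if "S \<in> sets borel" "negligible S" for S c
  proof -
    have "emeasure lborel S = 0" using that by (auto simp: negligible_iff_null_sets null_sets_def)
    then show "emeasure (density lborel (\<lambda>_. ennreal c)) S = 0"
      using that by (simp add: emeasure_density_const)
    have "negligible (g ` S)"
      using that(2) Lip by (intro negligible_locally_Lipschitz_image) (auto intro!: exI[of _ UNIV])
    moreover have "g ` S \<in> sets borel" using measurable_sets[OF km that(1)] by (simp add: kvim)
    ultimately show "emeasure \<nu> S = 0"
      using that by (auto simp: nuA kvim negligible_iff_null_sets null_sets_def)
  qed
  have "negligible (gap_set g 1 \<alpha> \<beta> \<inter> cbox a b)" for a b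
  proof -
    define E where "E = gap_set g 1 \<alpha> \<beta> \<inter> cbox a b"
    have E: "E \<in> sets borel" using gap_set_borel[OF cg] by (auto simp: E_def)
    have gE: "g ` E \<in> sets borel" using measurable_sets[OF km E] by (simp add: kvim)
    have Efin: "emeasure lborel E < \<infinity>"
      using emeasure_mono[of E "cbox a b" lborel] emeasure_lborel_cbox_finite[of a b]
      by (auto simp: E_def intro: le_less_trans)
    have q: "\<exists>h. h \<noteq> 0 \<and> \<bar>h\<bar> < d \<and> (g (t + h) - g t) / h < \<alpha>"
      "\<exists>h. h \<noteq> 0 \<and> \<bar>h\<bar> < d \<and> (g (t + h) - g t) / h > \<beta>" if "t \<in> E" "d > 0" for t d
      using that by (auto simp: E_def gap_set_def)
    have 1: "emeasure \<nu> E \<le> ennreal \<alpha> * emeasure lborel U" if U: "open U" "E \<subseteq> U" for U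
    proof -
      have "emeasure \<nu> E \<le> emeasure (density lborel (\<lambda>_. ennreal \<alpha>)) U"
      proof (rule Vitali_measure_le[OF _ _ null(2) E U])
        fix t d :: real assume t: "t \<in> E" and d: "d > 0"
        obtain h where h: "h \<noteq> 0" "\<bar>h\<bar> < d" "(g (t + h) - g t) / h < \<alpha>" using q(1)[OF t d] by auto
        have "(g (t + h) - g t) / h * \<bar>h\<bar> \<le> \<alpha> * \<bar>h\<bar>" using h by (intro mult_right_mono) auto
        then have "emeasure \<nu> (cball (t + h/2) (\<bar>h\<bar>/2)) \<le> emeasure (density lborel (\<lambda>_. ennreal \<alpha>)) (cball (t + h/2) (\<bar>h\<bar>/2))"
          using nucb[OF ivl(1)[OF h(1)]] lbcb[OF ivl(1)[OF h(1)] a0] ivl(3)[OF h(1)] by (auto intro!: ennreal_leI)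
        then show "\<exists>a r. 0 < r \<and> r < d \<and> t \<in> cball a r \<and>
          emeasure \<nu> (cball a r) \<le> emeasure (density lborel (\<lambda>_. ennreal \<alpha>)) (cball a r)"
          using ivl(1,2)[OF h(1)] h(2) by (intro exI[of _ "t + h/2"] exI[of _ "\<bar>h\<bar>/2"]) auto
      qed (auto simp: \<nu>_def)
      then show ?thesis using U by (simp add: emeasure_density_const)
    qed
    have 2: "ennreal \<beta> * emeasure lborel E \<le> emeasure \<nu> U" if U: "open U" "E \<subseteq> U" for U
    proof -
      have "emeasure (density lborel (\<lambda>_. ennreal \<beta>)) E \<le> emeasure \<nu> U"
      proof (rule Vitali_measure_le[OF _ _ null(1) E U])
        fix t d :: real assume t: "t \<in> E" and d: "d > 0"
        obtain h where h: "h \<noteq> 0" "\<bar>h\<bar> < d" "(g (t + h) - g t) / h > \<beta>" using q(2)[OF t d] by auto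
        have "(g (t + h) - g t) / h * \<bar>h\<bar> \<ge> \<beta> * \<bar>h\<bar>" using h by (intro mult_right_mono) auto
        then have "emeasure \<nu> (cball (t + h/2) (\<bar>h\<bar>/2)) \<ge> emeasure (density lborel (\<lambda>_. ennreal \<beta>)) (cball (t + h/2) (\<bar>h\<bar>/2))"
          using nucb[OF ivl(1)[OF h(1)]] lbcb[OF ivl(1)[OF h(1)] b0] ivl(3)[OF h(1)] by (auto intro!: ennreal_leI)
        then show "\<exists>a r. 0 < r \<and> r < d \<and> t \<in> cball a r \<and>
          emeasure (density lborel (\<lambda>_. ennreal \<beta>)) (cball a r) \<le> emeasure \<nu> (cball a r)"
          using ivl(1,2)[OF h(1)] h(2) by (intro exI[of _ "t + h/2"] exI[of _ "\<bar>h\<bar>/2"]) auto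
      qed (auto simp: \<nu>_def)
      then show ?thesis using E by (simp add: emeasure_density_const)
    qed
    have 3: "emeasure \<nu> E \<le> ennreal \<alpha> * emeasure lborel E"
    proof (rule ennreal_le_epsilon)
      fix e :: real assume e: "e > 0"
      obtain U where U: "open U" "E \<subseteq> U" "emeasure lborel U \<le> emeasure lborel E + ennreal (e/\<alpha>)"
        using lborel_outer_open[OF E, of "e/\<alpha>"] e a0 by auto
      have "emeasure \<nu> E \<le> ennreal \<alpha> * (emeasure lborel E + ennreal (e/\<alpha>))"
        using 1[OF U(1,2)] U(3) by (meson mult_left_mono order_trans zero_le)
      also have "\<dots> = ennreal \<alpha> * emeasure lborel E + ennreal e"
        using a0 e by (simp add: distrib_left ennreal_mult[symmetric])
      finally show "emeasure \<nu> E \<le> ennreal \<alpha> * emeasure lborel E + ennreal e" .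
    qed
    have 4: "ennreal \<beta> * emeasure lborel E \<le> emeasure \<nu> E"
    proof (rule ennreal_le_epsilon)
      fix e :: real assume e: "e > 0"
      \<comment> \<open>Outer approximation for \<open>\<nu>\<close> is done on the image side: the
        preimage under \<open>g\<close> of an open \<open>V\<close> around the image of
        \<open>E\<close> is open, and its \<open>\<nu>\<close>-measure is the Lebesgue measure of
        \<open>V\<close>.\<close>
      obtain V where V: "open V" "g ` E \<subseteq> V" "emeasure lborel V \<le> emeasure lborel (g ` E) + ennreal e"
        using lborel_outer_open[OF gE e] by auto
      have oU: "open (g -` V)" using cg V(1) by (simp add: open_vimage)
      have "ennreal \<beta> * emeasure lborel E \<le> emeasure \<nu> (g -` V)"
        using V by (intro 2 oU) auto
      also have "\<dots> = emeasure lborel V" using oU by (simp add: nuA vimage_def)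
      finally show "ennreal \<beta> * emeasure lborel E \<le> emeasure \<nu> E + ennreal e"
        using V(3) E by (simp add: nuA kvim)
    qed
    have "ennreal \<beta> * emeasure lborel E \<le> ennreal \<alpha> * emeasure lborel E" using 3 4 by auto
    moreover obtain w where w: "emeasure lborel E = ennreal w" "w \<ge> 0"
      using Efin by (cases "emeasure lborel E") auto
    ultimately have "\<beta> * w \<le> \<alpha> * w" using a0 b0 by (simp add: ennreal_mult[symmetric])
    then have "w = 0" using ab w by (smt (verit) mult_right_less_imp_less mult_strict_right_mono)
    then show ?thesis using w E by (auto simp: E_def negligible_iff_null_sets null_sets_def)
  qed
  then show ?thesis using negligible_on_intervals by blast
qed

text \<open>Adding \<open>(C + 1) * t\<close> lifts all slopes into the interval from 1 to 2C + 1
  and shifts every difference quotient, hence both thresholds, by C + 1.\<close>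

lemma gap_set_real_negligible:
  fixes f :: "real \<Rightarrow> real"
  assumes f: "C-lipschitz_on UNIV f" and "\<alpha> < \<beta>"
  shows "negligible (gap_set f 1 \<alpha> \<beta>)"
proof -
  define g where "g t = f t + (C + 1) * t" for t
  have C0: "C \<ge> 0" using f by (rule lipschitz_on_nonneg)
  have fl: "\<bar>f y - f x\<bar> \<le> C * (y - x)" if "x \<le> y" for x y
    using lipschitz_onD[OF f, of y x] that by (simp add: dist_real_def)
  have "negligible (gap_set g 1 (\<alpha> + (C + 1)) (\<beta> + (C + 1)))"
  proof (rule gap_set_bilipschitz_negligible[of 1 g "2 * C + 1"])
    show "1 * (y - x) \<le> g y - g x" "g y - g x \<le> (2 * C + 1) * (y - x)" if "x \<le> y" for x y
      using fl[OF that] by (auto simp: g_def algebra_simps)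
  qed (use assms in auto)
  moreover have "(g (t + h) - g t) / h = (f (t + h) - f t) / h + (C + 1)" if "h \<noteq> 0" for t h
    using that by (simp add: g_def field_simps)
  then have "gap_set g 1 (\<alpha> + (C + 1)) (\<beta> + (C + 1)) = gap_set f 1 \<alpha> \<beta>"
    by (simp add: gap_set_def cong: conj_cong)
  ultimately show ?thesis by simp
qed

text \<open>Averaging the indicator over the translates by t e, for t in the unit interval, does not
  change its integral, so Fubini needs no coordinate system adapted to e.\<close>

lemma negligible_if_lines_negligible:
  fixes N :: "'a::euclidean_space set"
  assumes N [measurable]: "N \<in> sets borel"
    and lines: "\<And>x. negligible {t::real. x + t *\<^sub>R e \<in> N}"
  shows "negligible N"
proof -
  have trans: "(\<integral>\<^sup>+x. indicator N (x + t *\<^sub>R e) \<partial>lborel) = emeasure lborel N" for t :: real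
  proof -
    have "emeasure lborel N = (\<integral>\<^sup>+x. indicator N x \<partial>distr lborel borel ((+) (t *\<^sub>R e)))"
      unfolding lborel_distr_plus by simp
    also have "\<dots> = (\<integral>\<^sup>+x. indicator N (t *\<^sub>R e + x) \<partial>lborel)"
      by (subst nn_integral_distr) auto
    finally show ?thesis by (simp add: add.commute)
  qed
  have "(\<integral>\<^sup>+t. indicator {0..1::real} t * (\<integral>\<^sup>+x. indicator N (x + t *\<^sub>R e) \<partial>lborel) \<partial>lborel)
      = (\<integral>\<^sup>+t. (\<integral>\<^sup>+x. indicator {0..1::real} t * indicator N (x + t *\<^sub>R e) \<partial>lborel) \<partial>lborel)"
    by (intro nn_integral_cong nn_integral_cmult[symmetric]) measurable
  also have "\<dots> = (\<integral>\<^sup>+x. (\<integral>\<^sup>+t. indicator {0..1::real} t * indicator N (x + t *\<^sub>R e) \<partial>lborel) \<partial>lborel)"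
    by (rule lborel_pair.Fubini') measurable
  also have "\<dots> = (\<integral>\<^sup>+(x::'a). 0 \<partial>lborel)"
  proof (rule nn_integral_cong)
    fix x
    have "{t. x + t *\<^sub>R e \<in> N} \<in> sets lborel" by measurable
    then have "{t. x + t *\<^sub>R e \<in> N} \<in> null_sets lborel"
      using lines[of x] by (auto simp: negligible_iff_null_sets null_sets_def)
    then have "AE t in lborel. t \<notin> {t. x + t *\<^sub>R e \<in> N}" by (rule AE_not_in)
    then show "(\<integral>\<^sup>+t. indicator {0..1::real} t * indicator N (x + t *\<^sub>R e) \<partial>lborel) = 0"
      by (subst nn_integral_0_iff_AE) (auto simp: indicator_def elim!: eventually_mono)
  qed
  finally have "emeasure lborel N = 0" by (simp add: trans nn_integral_multc)
  then show ?thesis using N by (auto simp: negligible_iff_null_sets null_sets_def)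
qed

lemma gap_set_negligible:
  fixes u :: "'a::euclidean_space \<Rightarrow> real"
  assumes u: "L-lipschitz_on UNIV u" and "\<alpha> < \<beta>"
  shows "negligible (gap_set u e \<alpha> \<beta>)"
proof (rule negligible_if_lines_negligible[where e = e])
  show "gap_set u e \<alpha> \<beta> \<in> sets borel"
    using u by (intro gap_set_borel lipschitz_on_continuous_on)
  fix x
  have "(L * norm e)-lipschitz_on UNIV (\<lambda>t. u (x + t *\<^sub>R e))"
  proof (rule lipschitz_onI)
    fix s t :: real
    have "dist (u (x + s *\<^sub>R e)) (u (x + t *\<^sub>R e)) \<le> L * dist (x + s *\<^sub>R e) (x + t *\<^sub>R e)"
      using u by (rule lipschitz_onD) auto
    also have "dist (x + s *\<^sub>R e) (x + t *\<^sub>R e) = norm e * dist s t"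
      by (simp add: dist_norm flip: scaleR_diff_left)
    finally show "dist (u (x + s *\<^sub>R e)) (u (x + t *\<^sub>R e)) \<le> L * norm e * dist s t"
      by (simp add: mult.assoc)
  qed (use lipschitz_on_nonneg[OF u] in auto)
  then have "negligible (gap_set (\<lambda>t. u (x + t *\<^sub>R e)) 1 \<alpha> \<beta>)"
    using assms(2) by (rule gap_set_real_negligible)
  then show "negligible {t. x + t *\<^sub>R e \<in> gap_set u e \<alpha> \<beta>}"
    by (simp add: gap_set_def scaleR_add_left add.assoc)
qed

text \<open>Off the countable union of rational gap sets the lower and upper limits of the quotient
  coincide, and the Lipschitz bound makes the common value finite.\<close>

lemma lipschitz_directional_derivative_AE:
  fixes u :: "'a::euclidean_space \<Rightarrow> real"
  assumes u: "L-lipschitz_on UNIV u"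
  shows "negligible {x. \<not> (\<exists>D. ((\<lambda>h. (u (x + h *\<^sub>R e) - u x) / h) \<longlongrightarrow> D) (at 0))}"
proof -
  define N where "N = (\<Union>(\<alpha>, \<beta>) \<in> {(\<alpha>, \<beta>). \<alpha> \<in> \<rat> \<and> \<beta> \<in> \<rat> \<and> \<alpha> < \<beta>}. gap_set u e \<alpha> \<beta>)"
  have "countable {(\<alpha>, \<beta>). \<alpha> \<in> \<rat> \<and> \<beta> \<in> \<rat> \<and> \<alpha> < (\<beta>::real)}"
    by (rule countable_subset[of _ "\<rat> \<times> \<rat>"]) (auto intro: countable_rat)
  then have N: "negligible N"
    unfolding N_def using gap_set_negligible[OF u] by (intro negligible_countable_Union) auto
  have "\<exists>D. ((\<lambda>h. (u (x + h *\<^sub>R e) - u x) / h) \<longlongrightarrow> D) (at 0)" if x: "x \<notin> N" for x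
  proof -
    define q where "q h = (u (x + h *\<^sub>R e) - u x) / h" for h
    \<comment> \<open>For \<open>h = 0\<close> the quotient is 0 because division by zero yields 0,
      so the bound holds for every \<open>h\<close>.\<close>
    have qb: "\<bar>q h\<bar> \<le> L * norm e" for h
    proof (cases "h = 0")
      case False
      have "\<bar>u (x + h *\<^sub>R e) - u x\<bar> \<le> L * norm e * \<bar>h\<bar>"
        using lipschitz_onD[OF u, of "x + h *\<^sub>R e" x] by (simp add: dist_norm mult_ac)
      then show ?thesis using False by (simp add: q_def abs_divide field_simps)
    qed (use lipschitz_on_nonneg[OF u] in \<open>auto simp: q_def\<close>)
    let ?Q = "\<lambda>h. ereal (q h)"
    have "Limsup (at 0) ?Q \<le> Liminf (at 0) ?Q"
    proof (rule ccontr)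
      assume "\<not> ?thesis"
      then have lt: "Liminf (at 0) ?Q < Limsup (at 0) ?Q" by simp
      \<comment> \<open>Three intermediate reals leave two disjoint gaps, one for each rational, so
        that \<alpha> < \<beta> lie strictly between the two limits.\<close>
      obtain a' where a': "Liminf (at 0) ?Q < ereal a'" "ereal a' < Limsup (at 0) ?Q"
        using ereal_dense2[OF lt] by auto
      obtain b' where b': "ereal a' < ereal b'" "ereal b' < Limsup (at 0) ?Q"
        using ereal_dense2[OF a'(2)] by auto
      obtain c' where c': "ereal b' < ereal c'" "ereal c' < Limsup (at 0) ?Q"
        using ereal_dense2[OF b'(2)] by auto
      obtain \<alpha> where al: "\<alpha> \<in> \<rat>" "a' < \<alpha>" "\<alpha> < b'" using Rats_dense_in_real b'(1) by auto
      obtain \<beta> where be: "\<beta> \<in> \<rat>" "b' < \<beta>" "\<beta> < c'" using Rats_dense_in_real c'(1) by auto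
      have "x \<notin> gap_set u e \<alpha> \<beta>" using x al be by (force simp: N_def)
      then obtain d where d: "d > 0"
        "(\<forall>h. 0 < \<bar>h\<bar> \<and> \<bar>h\<bar> < d \<longrightarrow> \<alpha> \<le> q h) \<or> (\<forall>h. 0 < \<bar>h\<bar> \<and> \<bar>h\<bar> < d \<longrightarrow> q h \<le> \<beta>)"
        unfolding gap_set_def q_def mem_Collect_eq by (meson not_less)
      have ev: "eventually (\<lambda>h. 0 < \<bar>h\<bar> \<and> \<bar>h\<bar> < d) (at (0::real))"
        using d(1) by (auto simp: eventually_at intro!: exI[of _ d])
      from d(2) show False
      proof
        assume "\<forall>h. 0 < \<bar>h\<bar> \<and> \<bar>h\<bar> < d \<longrightarrow> \<alpha> \<le> q h"
        then have "ereal \<alpha> \<le> Liminf (at 0) ?Q"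
          by (intro Liminf_bounded eventually_mono[OF ev]) auto
        then have "ereal \<alpha> < ereal a'" using a'(1) by (rule le_less_trans)
        then show False using al by simp
      next
        assume "\<forall>h. 0 < \<bar>h\<bar> \<and> \<bar>h\<bar> < d \<longrightarrow> q h \<le> \<beta>"
        then have "Limsup (at 0) ?Q \<le> ereal \<beta>"
          by (intro Limsup_bounded eventually_mono[OF ev]) auto
        with c'(2) have "ereal c' < ereal \<beta>" by (rule less_le_trans)
        then show False using be by simp
      qed
    qed
    then have eq: "Liminf (at 0) ?Q = Limsup (at 0) ?Q"
      using Liminf_le_Limsup[of "at 0" ?Q] by (intro antisym) auto
    then have lim: "(?Q \<longlongrightarrow> Liminf (at 0) ?Q) (at 0)"
      by (subst tendsto_iff_Liminf_eq_Limsup) auto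
    have qb': "- (L * norm e) \<le> q h" "q h \<le> L * norm e" for h
      using qb[of h] by linarith+
    have "ereal (- (L * norm e)) \<le> Liminf (at 0) ?Q"
      using qb'(1) by (intro Liminf_bounded always_eventually allI) (simp only: ereal_less_eq(3))
    moreover have "Limsup (at 0) ?Q \<le> ereal (L * norm e)"
      using qb'(2) by (intro Limsup_bounded always_eventually allI) (simp only: ereal_less_eq(3))
    ultimately obtain D where "Liminf (at 0) ?Q = ereal D"
      unfolding eq by (cases "Limsup (at 0) ?Q") auto
    then show ?thesis using lim by (auto simp: q_def)
  qed
  then show ?thesis by (intro negligible_subset[OF N]) auto
qed

section \<open>Porous sets\<close>

text \<open>The hole takes the fraction \<open>\<theta> ^ DIM('a)\<close> of the ball, so
  \<open>E\<close> fills at most the fraction \<open>\<kappa>\<close> of it. Vitali coverings bound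
  the measure of a bounded part of \<open>A\<close> by \<open>\<kappa>\<close> times that of any
  open superset, hence by \<open>\<kappa> < 1\<close> times itself.\<close>

lemma negligible_if_porous:
  fixes A E :: "'a::euclidean_space set"
  assumes A: "A \<in> sets borel" "A \<subseteq> E" and E: "E \<in> sets borel" and \<theta>: "0 < \<theta>" "\<theta> \<le> 1"
    and porous: "\<And>x d. x \<in> A \<Longrightarrow> 0 < d \<Longrightarrow>
      \<exists>R y. 0 < R \<and> R < d \<and> ball y (\<theta> * R) \<subseteq> cball x R \<and> ball y (\<theta> * R) \<inter> E = {}"
  shows "negligible A"
proof -
  define \<kappa> where "\<kappa> = 1 - \<theta> ^ DIM('a)"
  have \<kappa>: "0 \<le> \<kappa>" "\<kappa> < 1" using \<theta> by (auto simp: \<kappa>_def power_le_one)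
  have ME: "emeasure (density lborel (indicator E)) S = emeasure lborel (S \<inter> E)" if "S \<in> sets borel" for S
  proof -
    have "emeasure (density lborel (indicator E)) S = (\<integral>\<^sup>+x. indicator (S \<inter> E) x \<partial>lborel)"
    proof (subst emeasure_density)
      show "(\<integral>\<^sup>+x. indicator E x * indicator S x \<partial>lborel) = (\<integral>\<^sup>+x. indicator (S \<inter> E) x \<partial>lborel)"
        by (rule nn_integral_cong) (auto simp: indicator_def)
    qed (use that E in auto)
    then show ?thesis using that E by simp
  qed
  have "negligible (A \<inter> cbox a b)" for a b
  proof -
    define B where "B = A \<inter> cbox a b"
    have B: "B \<in> sets borel" "B \<subseteq> E" "B \<subseteq> A" using A by (auto simp: B_def)
    have Bfin: "emeasure lborel B < \<infinity>"
      using emeasure_mono[of B "cbox a b" lborel] emeasure_lborel_cbox_finite[of a b]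
      by (auto simp: B_def intro: le_less_trans)
    have 1: "emeasure lborel B \<le> ennreal \<kappa> * emeasure lborel U" if U: "open U" "B \<subseteq> U" for U
    proof -
      have "emeasure (density lborel (indicator E)) B \<le> emeasure (density lborel (\<lambda>_. ennreal \<kappa>)) U"
      proof (rule Vitali_measure_le[OF _ _ _ B(1) U])
        fix S :: "'a set" assume S: "S \<in> sets borel" "negligible S"
        have "emeasure lborel (S \<inter> E) \<le> emeasure lborel S" using S(1) by (intro emeasure_mono) auto
        also have "\<dots> = 0" using S by (auto simp: negligible_iff_null_sets null_sets_def)
        finally show "emeasure (density lborel (indicator E)) S = 0" using S by (simp add: ME)
      next
        fix x and d :: real assume x: "x \<in> B" and d: "0 < d"
        obtain R y where R: "0 < R" "R < d" "ball y (\<theta> * R) \<subseteq> cball x R" "ball y (\<theta> * R) \<inter> E = {}"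
          using porous[of x d] x d B(3) by auto
        have "emeasure lborel (cball x R \<inter> E) \<le> emeasure lborel (cball x R - ball y (\<theta> * R))"
          using R(4) by (intro emeasure_mono) auto
        also have "\<dots> = ennreal (measure lborel (cball x R - ball y (\<theta> * R)))"
          by (rule emeasure_eq_ennreal_measure)
             (use emeasure_mono[of "cball x R - ball y (\<theta> * R)" "cball x R" lborel] emeasure_bounded_finite[of "cball x R"]
              in \<open>auto simp: top_unique\<close>)
        also have "measure lborel (cball x R - ball y (\<theta> * R)) = measure lborel (cball x R) - measure lborel (ball y (\<theta> * R))"
          using R(3) emeasure_bounded_finite[of "cball x R"] by (intro measure_Diff) auto
        also have "\<dots> = \<kappa> * measure lborel (cball x R)"
          using R(1) \<theta> content_ball_conv_unit_ball[of R x] content_ball_conv_unit_ball[of "\<theta> * R" y]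
          by (simp add: content_cball_conv_ball \<kappa>_def algebra_simps power_mult_distrib)
        also have "ennreal (\<kappa> * measure lborel (cball x R)) = ennreal \<kappa> * emeasure lborel (cball x R)"
          using \<kappa> emeasure_bounded_finite[of "cball x R"]
          by (subst emeasure_eq_ennreal_measure) (auto simp: ennreal_mult)
        finally have "emeasure (density lborel (indicator E)) (cball x R)
            \<le> emeasure (density lborel (\<lambda>_. ennreal \<kappa>)) (cball x R)"
          by (simp add: ME emeasure_density_const)
        then show "\<exists>a r. 0 < r \<and> r < d \<and> x \<in> cball a r \<and>
            emeasure (density lborel (indicator E)) (cball a r) \<le> emeasure (density lborel (\<lambda>_. ennreal \<kappa>)) (cball a r)"
          using R(1,2) by (intro exI[of _ x] exI[of _ R]) auto
      qed auto
      then show ?thesis using U B by (simp add: ME emeasure_density_const Int_absorb2)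
    qed
    have "emeasure lborel B \<le> ennreal \<kappa> * emeasure lborel B"
    proof (rule ennreal_le_epsilon)
      fix e :: real assume e: "e > 0"
      obtain U where U: "open U" "B \<subseteq> U" "emeasure lborel U \<le> emeasure lborel B + ennreal e"
        using lborel_outer_open[OF B(1) e] by auto
      have "emeasure lborel B \<le> ennreal \<kappa> * (emeasure lborel B + ennreal e)"
        using 1[OF U(1,2)] U(3) by (meson mult_left_mono order_trans zero_le)
      also have "\<dots> = ennreal \<kappa> * emeasure lborel B + ennreal (\<kappa> * e)"
        using \<kappa> e by (simp add: distrib_left ennreal_mult)
      also have "\<dots> \<le> ennreal \<kappa> * emeasure lborel B + ennreal e"
        using \<kappa> e by (intro add_left_mono ennreal_leI) (simp add: mult_left_le_one_le)
      finally show "emeasure lborel B \<le> ennreal \<kappa> * emeasure lborel B + ennreal e" .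
    qed
    moreover obtain w where w: "emeasure lborel B = ennreal w" "w \<ge> 0"
      using Bfin by (cases "emeasure lborel B") auto
    ultimately have "w \<le> \<kappa> * w" using \<kappa> by (simp add: ennreal_mult[symmetric])
    then have "w = 0" using \<kappa> w by (smt (verit) mult_less_cancel_right2)
    then show ?thesis using w B by (auto simp: B_def negligible_iff_null_sets null_sets_def)
  qed
  then show ?thesis using negligible_on_intervals by blast
qed

section \<open>Rademacher's theorem\<close>

text \<open>Walk from \<open>x\<close> to \<open>x + h\<close> one coordinate at a time. Every
  corner stays within \<open>DIM('a) * norm h\<close> of \<open>x\<close> and has a point of
  \<open>E\<close> within \<open>c * norm h\<close>, where the increment is known; moving both ends
  of the edge there costs at most \<open>2 * L * c * norm h\<close>.\<close>

lemma increment_along_coordinates: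
  fixes u :: "'a::euclidean_space \<Rightarrow> real" and L c \<epsilon> :: real
  assumes u: "L-lipschitz_on UNIV u"
    and E: "\<And>z b t. z \<in> E \<Longrightarrow> b \<in> Basis \<Longrightarrow> \<bar>t\<bar> \<le> norm h \<Longrightarrow>
      \<bar>u (z + t *\<^sub>R b) - u z - t * (p \<bullet> b)\<bar> \<le> \<epsilon> * \<bar>t\<bar>"
    and near: "\<And>y. dist x y \<le> DIM('a) * norm h \<Longrightarrow> \<exists>z\<in>E. dist y z < c * norm h"
    and "0 \<le> \<epsilon>"
  shows "\<bar>u (x + h) - u x - p \<bullet> h\<bar> \<le> DIM('a) * (\<epsilon> + 2 * L * c) * norm h"
proof -
  have L0: "L \<ge> 0" using u by (rule lipschitz_on_nonneg)
  \<comment> \<open>The displacement after the coordinates in \<open>S\<close>, which turns the walk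
    into an induction over subsets of \<open>Basis\<close>.\<close>
  define w where "w S = (\<Sum>b\<in>S. (h \<bullet> b) *\<^sub>R b)" for S :: "'a set"
  have "\<bar>u (x + w S) - u x - (\<Sum>b\<in>S. (h \<bullet> b) * (p \<bullet> b))\<bar> \<le> card S * ((\<epsilon> + 2 * L * c) * norm h)"
    if "S \<subseteq> Basis" for S
    using finite_subset[OF that finite_Basis] that
  proof (induction S rule: finite_induct)
    case empty
    then show ?case by (simp add: w_def)
  next
    case (insert b S)
    define t where "t = h \<bullet> b"
    define y where "y = x + w S"
    have b: "b \<in> Basis" and S: "S \<subseteq> Basis" using insert by auto
    have t: "\<bar>t\<bar> \<le> norm h" using Basis_le_norm[OF b] by (simp add: t_def)
    have "norm (w S) \<le> (\<Sum>b\<in>S. norm ((h \<bullet> b) *\<^sub>R b))" unfolding w_def by (rule norm_sum)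
    also have "\<dots> \<le> (\<Sum>b\<in>S. norm h)" using S by (intro sum_mono) (simp add: subset_iff Basis_le_norm)
    also have "\<dots> \<le> DIM('a) * norm h" using S by (auto intro!: mult_right_mono card_mono)
    finally obtain z where z: "z \<in> E" "dist y z < c * norm h"
      using near[of y] by (auto simp: y_def dist_norm)
    have "\<bar>u (y + t *\<^sub>R b) - u (z + t *\<^sub>R b)\<bar> \<le> L * dist y z" "\<bar>u y - u z\<bar> \<le> L * dist y z"
      using lipschitz_onD[OF u, of "y + t *\<^sub>R b" "z + t *\<^sub>R b"] lipschitz_onD[OF u, of y z]
      by (auto simp: dist_real_def)
    moreover have "L * dist y z \<le> L * (c * norm h)" using z(2) L0 by (intro mult_left_mono) auto
    moreover have "\<bar>u (z + t *\<^sub>R b) - u z - t * (p \<bullet> b)\<bar> \<le> \<epsilon> * norm h"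
      using E[OF z(1) b t] mult_left_mono[OF t assms(4)] by linarith
    ultimately have step: "\<bar>u (y + t *\<^sub>R b) - u y - t * (p \<bullet> b)\<bar> \<le> (\<epsilon> + 2 * L * c) * norm h"
      by (simp add: algebra_simps)
    have eq: "x + w (insert b S) = y + t *\<^sub>R b"
      using insert(1,2) by (simp add: w_def y_def t_def)
    have IH: "\<bar>u y - u x - (\<Sum>b\<in>S. (h \<bullet> b) * (p \<bullet> b))\<bar> \<le> card S * ((\<epsilon> + 2 * L * c) * norm h)"
      using insert.IH S by (simp add: y_def)
    have "(\<Sum>b\<in>insert b S. (h \<bullet> b) * (p \<bullet> b)) = t * (p \<bullet> b) + (\<Sum>b\<in>S. (h \<bullet> b) * (p \<bullet> b))"
      using insert(1,2) by (simp add: t_def)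
    moreover have "real (card (insert b S)) * ((\<epsilon> + 2 * L * c) * norm h)
      = (\<epsilon> + 2 * L * c) * norm h + card S * ((\<epsilon> + 2 * L * c) * norm h)"
      using insert(1,2) by (simp add: algebra_simps)
    ultimately show ?case using IH step unfolding eq by linarith
  qed
  from this[of Basis] show ?thesis
    by (simp add: w_def euclidean_representation euclidean_inner[of p h] mult_ac)
qed

text \<open>A point where all partial derivatives exist lies in some
  \<open>E q \<epsilon> \<delta>\<close> with \<open>q\<close> from a countable dense set. If
  approximation by \<open>q\<close> still fails there at arbitrarily small \<open>h\<close>, then by
  \<open>increment_along_coordinates\<close> the set \<open>E q \<epsilon> \<delta>\<close> misses a
  ball near the point of radius comparable to \<open>norm h\<close>. Such points form a porous
  set.\<close>

theorem rademacher:
  fixes u :: "'a::euclidean_space \<Rightarrow> real"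
  assumes u: "L-lipschitz_on UNIV u"
  shows "negligible {x. \<not> u differentiable (at x)}"
proof -
  define n where "n = real (DIM('a))"
  have n1: "n \<ge> 1" by (simp add: n_def)
  have L0: "L \<ge> 0" using u by (rule lipschitz_on_nonneg)
  have cu: "continuous_on UNIV u" using u by (rule lipschitz_on_continuous_on)
  define N1 where "N1 = (\<Union>b\<in>Basis. {x. \<not> (\<exists>D. ((\<lambda>h. (u (x + h *\<^sub>R b) - u x) / h) \<longlongrightarrow> D) (at 0))})"
  have N1: "negligible N1"
    unfolding N1_def using lipschitz_directional_derivative_AE[OF u] by (intro negligible_Union) auto
  define E where "E p \<epsilon> \<delta> = {x. \<forall>b\<in>Basis. \<forall>t. \<bar>t\<bar> < \<delta> \<longrightarrow>
      \<bar>u (x + t *\<^sub>R b) - u x - t * (p \<bullet> b)\<bar> \<le> \<epsilon> * \<bar>t\<bar>}" for p :: 'a and \<epsilon> \<delta> :: real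
  define O' where "O' p \<epsilon> d = {x. \<exists>h. norm h < d \<and> 2 * n * \<epsilon> * norm h < \<bar>u (x + h) - u x - p \<bullet> h\<bar>}"
    for p :: 'a and \<epsilon> d :: real
  define A where "A p \<epsilon> \<delta> = E p \<epsilon> \<delta> \<inter> (\<Inter>k::nat. O' p \<epsilon> (inverse (Suc k)))" for p \<epsilon> \<delta>
  have E: "closed (E p \<epsilon> \<delta>)" for p \<epsilon> \<delta>
  proof -
    have eq: "E p \<epsilon> \<delta> = (\<Inter>b\<in>Basis. \<Inter>t\<in>{t. \<bar>t\<bar> < \<delta>}. {x. \<bar>u (x + t *\<^sub>R b) - u x - t * (p \<bullet> b)\<bar> \<le> \<epsilon> * \<bar>t\<bar>})"
      by (auto simp: E_def)
    show ?thesis unfolding eq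
      by (intro closed_INT ballI closed_Collect_le continuous_intros continuous_on_compose2[OF cu]) auto
  qed
  have O': "open (O' p \<epsilon> d)" for p \<epsilon> d
  proof -
    have eq: "O' p \<epsilon> d = (\<Union>h\<in>{h. norm h < d}. {x. 2 * n * \<epsilon> * norm h < \<bar>u (x + h) - u x - p \<bullet> h\<bar>})"
      by (auto simp: O'_def)
    show ?thesis unfolding eq
      by (intro open_UN ballI open_Collect_less continuous_intros continuous_on_compose2[OF cu]) auto
  qed
  have A: "negligible (A p \<epsilon> \<delta>)" if \<epsilon>: "\<epsilon> > 0" and \<delta>: "\<delta> > 0" for p \<epsilon> \<delta>
  proof -
    \<comment> \<open>Hole size: \<open>2 * L * c \<le> \<epsilon>\<close> keeps the increment in
      the absence of holes below \<open>2 * n * \<epsilon> * norm h\<close>, the threshold in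
      \<open>O'\<close>.\<close>
    define c where "c = \<epsilon> / (2 * L + 1)"
    have c: "c > 0" "2 * L * c \<le> \<epsilon>" using L0 \<epsilon> by (auto simp: c_def field_simps)
    show ?thesis
    proof (rule negligible_if_porous[where E = "E p \<epsilon> \<delta>" and \<theta> = "c / (n + c)"])
      show "A p \<epsilon> \<delta> \<in> sets borel" using E O' by (auto simp: A_def borel_closed borel_open)
      show "0 < c / (n + c)" "c / (n + c) \<le> 1" using c n1 by auto
      fix x d assume x: "x \<in> A p \<epsilon> \<delta>" and d: "(0::real) < d"
      obtain k where k: "inverse (real (Suc k)) < min \<delta> (d / (n + c))"
        using reals_Archimedean[of "min \<delta> (d / (n + c))"] \<delta> d c n1 by auto
      have "x \<in> O' p \<epsilon> (inverse (Suc k))" using x by (auto simp: A_def)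
      then obtain h where h: "norm h < inverse (Suc k)" "2 * n * \<epsilon> * norm h < \<bar>u (x + h) - u x - p \<bullet> h\<bar>"
        by (auto simp: O'_def)
      have h0: "norm h > 0" using h(2) by auto
      have hd: "norm h < \<delta>" "norm h < d / (n + c)" using h(1) k by auto
      have "\<exists>y. dist x y \<le> n * norm h \<and> ball y (c * norm h) \<inter> E p \<epsilon> \<delta> = {}"
      proof (rule ccontr)
        assume "\<not> ?thesis"
        then have near: "\<exists>z\<in>E p \<epsilon> \<delta>. dist y z < c * norm h" if "dist x y \<le> DIM('a) * norm h" for y
          using that unfolding n_def by (meson disjoint_iff mem_ball)
        have "\<bar>u (x + h) - u x - p \<bullet> h\<bar> \<le> DIM('a) * (\<epsilon> + 2 * L * c) * norm h"
          using hd \<epsilon> by (intro increment_along_coordinates[OF u _ near]) (auto simp: E_def)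
        also have "\<dots> \<le> n * (\<epsilon> + \<epsilon>) * norm h"
          using c n1 unfolding n_def by (intro mult_right_mono mult_left_mono) auto
        finally show False using h(2) by (simp add: algebra_simps)
      qed
      then obtain y where y: "dist x y \<le> n * norm h" "ball y (c * norm h) \<inter> E p \<epsilon> \<delta> = {}" by auto
      \<comment> \<open>The hole has radius \<open>c * norm h\<close> and centre within
        \<open>n * norm h\<close> of \<open>x\<close>, so this ball contains it; the ratio of the
        radii is \<open>c / (n + c)\<close>.\<close>
      define R where "R = (n + c) * norm h"
      have nc: "n + c > 0" using c n1 by auto
      have R: "R > 0" "R < d" "c / (n + c) * R = c * norm h"
        using h0 hd(2) nc by (simp_all add: R_def less_divide_eq mult.commute)
      have "ball y (c * norm h) \<subseteq> cball x R"
      proof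
        fix z assume "z \<in> ball y (c * norm h)"
        then have "dist x z \<le> n * norm h + c * norm h"
          using dist_triangle[of x z y] y(1) by auto
        then show "z \<in> cball x R" by (simp add: R_def algebra_simps)
      qed
      then show "\<exists>R y. 0 < R \<and> R < d \<and> ball y (c / (n + c) * R) \<subseteq> cball x R \<and> ball y (c / (n + c) * R) \<inter> E p \<epsilon> \<delta> = {}"
        using R y by (intro exI[of _ R] exI[of _ y]) auto
    qed (use E in \<open>auto simp: A_def borel_closed\<close>)
  qed
  obtain Q :: "'a set" where Q: "countable Q" "closure Q = UNIV"
    using separable[of "UNIV::'a set"] by (metis top.extremum_uniqueI)
  define N2 where "N2 = (\<Union>(p, i, j) \<in> Q \<times> (UNIV::nat set) \<times> (UNIV::nat set). A p (inverse (Suc i)) (inverse (Suc j)))"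
  have N2: "negligible N2"
    unfolding N2_def using Q(1) A by (intro negligible_countable_Union) auto
  have "u differentiable (at x)" if x: "x \<notin> N1" "x \<notin> N2" for x
  proof -
    have "\<forall>b\<in>Basis. \<exists>D. ((\<lambda>h. (u (x + h *\<^sub>R b) - u x) / h) \<longlongrightarrow> D) (at 0)"
      using x(1) by (auto simp: N1_def)
    then obtain D where D: "\<And>b. b \<in> Basis \<Longrightarrow> ((\<lambda>h. (u (x + h *\<^sub>R b) - u x) / h) \<longlongrightarrow> D b) (at 0)"
      by metis
    define p where "p = (\<Sum>b\<in>Basis. D b *\<^sub>R b)"
    have pb: "p \<bullet> b = D b" if "b \<in> Basis" for b using that by (simp add: p_def)
    have "\<exists>d>0. \<forall>h. norm h < d \<longrightarrow> \<bar>u (x + h) - u x - p \<bullet> h\<bar> \<le> e * norm h" if e: "e > 0" for e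
    proof -
      \<comment> \<open>The error budget is 2n + 1 times \<epsilon>: 2n from lying outside some
        \<open>O'\<close>, and 1 from replacing \<open>q\<close> by the vector \<open>p\<close> of
        partial derivatives.\<close>
      obtain i where i: "inverse (real (Suc i)) < e / (2 * n + 1)"
        using reals_Archimedean[of "e / (2 * n + 1)"] e n1 by auto
      define \<epsilon> where "\<epsilon> = inverse (real (Suc i))"
      have \<epsilon>: "\<epsilon> > 0" "(2 * n + 1) * \<epsilon> \<le> e"
        using i n1 unfolding \<epsilon>_def[symmetric] by (simp_all add: \<epsilon>_def[symmetric] less_divide_eq mult.commute) (simp add: \<epsilon>_def)
      \<comment> \<open>Half of \<epsilon> pays for the distance of \<open>q\<close> from
        \<open>p\<close>, the other half for the convergence of the quotients; together they put
        \<open>x\<close> into \<open>E\<close>.\<close>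
      obtain q where q: "q \<in> Q" "dist q p < \<epsilon> / 2"
        using Q(2) \<epsilon>(1) closure_approachable[of p Q] by (metis UNIV_I half_gt_zero)
      have "eventually (\<lambda>h. \<bar>(u (x + h *\<^sub>R b) - u x) / h - p \<bullet> b\<bar> < \<epsilon> / 2) (at 0)" if "b \<in> Basis" for b
        using tendstoD[OF D[OF that], of "\<epsilon>/2"] \<epsilon>(1) by (simp add: dist_real_def pb that)
      then have "eventually (\<lambda>h. \<forall>b\<in>Basis. \<bar>(u (x + h *\<^sub>R b) - u x) / h - p \<bullet> b\<bar> < \<epsilon> / 2) (at 0)"
        by (simp add: eventually_ball_finite)
      then obtain \<delta> where \<delta>: "\<delta> > 0" "\<And>h b. h \<noteq> 0 \<Longrightarrow> \<bar>h\<bar> < \<delta> \<Longrightarrow> b \<in> Basis \<Longrightarrow>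
          \<bar>(u (x + h *\<^sub>R b) - u x) / h - p \<bullet> b\<bar> < \<epsilon> / 2"
        unfolding eventually_at by (auto simp: dist_real_def)
      obtain j where j: "inverse (real (Suc j)) < \<delta>" using reals_Archimedean[OF \<delta>(1)] by auto
      have "x \<in> E q \<epsilon> (inverse (Suc j))"
        unfolding E_def mem_Collect_eq
      proof (intro ballI allI impI)
        fix b :: 'a and t :: real assume b: "b \<in> Basis" and t: "\<bar>t\<bar> < inverse (Suc j)"
        show "\<bar>u (x + t *\<^sub>R b) - u x - t * (q \<bullet> b)\<bar> \<le> \<epsilon> * \<bar>t\<bar>"
        proof (cases "t = 0")
          case False
          have "\<bar>(q - p) \<bullet> b\<bar> \<le> \<epsilon> / 2" using Basis_le_norm[OF b, of "q - p"] q(2) by (simp add: dist_norm)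
          moreover have "\<bar>(u (x + t *\<^sub>R b) - u x) / t - p \<bullet> b\<bar> < \<epsilon> / 2" using \<delta>(2)[of t b] False t j b by auto
          ultimately have "\<bar>(u (x + t *\<^sub>R b) - u x) / t - q \<bullet> b\<bar> \<le> \<epsilon>"
            unfolding inner_diff_left by linarith
          then have "\<bar>(u (x + t *\<^sub>R b) - u x) / t - q \<bullet> b\<bar> * \<bar>t\<bar> \<le> \<epsilon> * \<bar>t\<bar>" by (intro mult_right_mono) auto
          then have "\<bar>((u (x + t *\<^sub>R b) - u x) / t - q \<bullet> b) * t\<bar> \<le> \<epsilon> * \<bar>t\<bar>" by (simp add: abs_mult)
          moreover have "((u (x + t *\<^sub>R b) - u x) / t - q \<bullet> b) * t = u (x + t *\<^sub>R b) - u x - t * (q \<bullet> b)"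
            using False by (simp add: field_simps)
          ultimately show ?thesis by simp
        qed auto
      qed
      moreover have "x \<notin> A q \<epsilon> (inverse (Suc j))"
        using x(2) q(1) by (force simp: N2_def \<epsilon>_def)
      ultimately obtain k where k: "x \<notin> O' q \<epsilon> (inverse (Suc k))"
        by (auto simp: A_def)
      show ?thesis
      proof (intro exI[of _ "inverse (real (Suc k))"] conjI allI impI)
        fix h :: 'a assume "norm h < inverse (real (Suc k))"
        then have "\<bar>u (x + h) - u x - q \<bullet> h\<bar> \<le> 2 * n * \<epsilon> * norm h" using k by (force simp: O'_def)
        moreover have "\<bar>(q - p) \<bullet> h\<bar> \<le> \<epsilon> * norm h"
          using Cauchy_Schwarz_ineq2[of "q - p" h] q(2) \<epsilon>(1)
          by (smt (verit) dist_norm half_gt_zero mult_right_mono norm_ge_zero field_sum_of_halves)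
        ultimately have "\<bar>u (x + h) - u x - p \<bullet> h\<bar> \<le> 2 * n * \<epsilon> * norm h + \<epsilon> * norm h"
          unfolding inner_diff_left by linarith
        also have "\<dots> \<le> e * norm h"
          using mult_right_mono[OF \<epsilon>(2), of "norm h"] by (simp add: algebra_simps)
        finally show "\<bar>u (x + h) - u x - p \<bullet> h\<bar> \<le> e * norm h" .
      qed auto
    qed
    then have d: "\<exists>d>0. \<forall>y. norm (y - x) < d \<longrightarrow> norm (u y - u x - p \<bullet> (y - x)) \<le> e * norm (y - x)" if "e > 0" for e
      using that by (metis add.commute diff_add_cancel real_norm_def)
    have "(u has_derivative (\<lambda>h. p \<bullet> h)) (at x)"
      unfolding has_derivative_at_alt using d by (auto intro: bounded_linear_inner_right)
    then show ?thesis by (rule differentiableI)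
  qed
  then have "{x. \<not> u differentiable (at x)} \<subseteq> N1 \<union> N2" by auto
  then show ?thesis by (rule negligible_subset[OF negligible_Un[OF N1 N2]])
qed

section \<open>Gradients and integration by parts\<close>

text \<open>A segment from a point of \<open>S\<close> to a point outside meets the frontier, where
  \<open>g\<close> vanishes; hence the constant does not grow.\<close>

lemma lipschitz_on_zero_extension:
  fixes g :: "'a::euclidean_space \<Rightarrow> real"
  assumes S: "closed S" and g: "C-lipschitz_on S g" and zero: "\<And>x. x \<in> frontier S \<Longrightarrow> g x = 0"
  shows "C-lipschitz_on UNIV (\<lambda>x. if x \<in> S then g x else 0)"
proof -
  have C: "C \<ge> 0" using g by (rule lipschitz_on_nonneg)
  have cross: "\<bar>g x\<bar> \<le> C * dist x y" if "x \<in> S" "y \<notin> S" for x y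
  proof -
    have "closed_segment x y \<inter> frontier S \<noteq> {}"
      using that by (intro connected_Int_frontier) auto
    then obtain z where z: "z \<in> closed_segment x y" "z \<in> frontier S" by auto
    have "z \<in> S" using z(2) S frontier_subset_closed by auto
    then have "\<bar>g x\<bar> \<le> C * dist x z"
      using lipschitz_onD[OF g that(1), of z] zero[OF z(2)] by (simp add: dist_real_def)
    also have "\<dots> \<le> C * dist x y"
      using segment_bound(1)[OF z(1)] C by (intro mult_left_mono) (auto simp: dist_norm norm_minus_commute)
    finally show ?thesis .
  qed
  show ?thesis
  proof (rule lipschitz_onI[OF _ C])
    fix x y
    show "dist (if x \<in> S then g x else 0) (if y \<in> S then g y else 0) \<le> C * dist x y"
      using cross[of x y] cross[of y x] lipschitz_onD[OF g, of x y] C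
      by (auto simp: dist_commute dist_real_def)
  qed
qed

lemma grad_eqI:
  assumes "(v has_derivative (\<lambda>h. p \<bullet> h)) (at x)"
  shows "grad v x = p"
proof -
  have "(v has_derivative (\<lambda>h. grad v x \<bullet> h)) (at x)"
    unfolding grad_def using assms by (rule someI)
  then have "(\<lambda>h. grad v x \<bullet> h) = (\<lambda>h. p \<bullet> h)"
    using assms by (rule has_derivative_unique)
  then have "grad v x \<bullet> (grad v x - p) = p \<bullet> (grad v x - p)" by metis
  then have "(grad v x - p) \<bullet> (grad v x - p) = 0" by (simp add: inner_diff_left)
  then show ?thesis by simp
qed

lemma has_derivative_grad:
  assumes "v differentiable (at x)"
  shows "(v has_derivative (\<lambda>h. grad v x \<bullet> h)) (at x)"
proof -
  obtain f' where f': "(v has_derivative f') (at x)" using assms by (auto simp: differentiable_def)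
  have lin: "linear f'" using f' by (rule has_derivative_linear)
  define p where "p = (\<Sum>b\<in>Basis. f' b *\<^sub>R b)"
  have "f' h = p \<bullet> h" for h
  proof -
    have "f' h = f' (\<Sum>b\<in>Basis. (h \<bullet> b) *\<^sub>R b)" by (simp add: euclidean_representation)
    also have "\<dots> = (\<Sum>b\<in>Basis. (h \<bullet> b) * f' b)" using lin by (simp add: linear_sum linear_scale)
    also have "\<dots> = p \<bullet> h" by (simp add: p_def inner_sum_left inner_commute[of h] mult.commute)
    finally show ?thesis .
  qed
  then have "(v has_derivative (\<lambda>h. p \<bullet> h)) (at x)" using f' by presburger
  then show ?thesis using grad_eqI by blast
qed

text \<open>The two predicates under \<open>SOME\<close> coincide, so the values agree even at
  points where \<open>v\<close> is not differentiable.\<close>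

lemma grad_cong_open:
  assumes "open S" "x \<in> S" "\<And>y. y \<in> S \<Longrightarrow> v y = w y"
  shows "grad v x = grad w x"
proof -
  have "(v has_derivative (\<lambda>h. p \<bullet> h)) (at x) = (w has_derivative (\<lambda>h. p \<bullet> h)) (at x)" for p
    using has_derivative_transform_within_open[OF _ assms(1,2)] assms(3) by metis
  then show ?thesis by (simp add: grad_def)
qed

lemma grad_const [simp]: "grad (\<lambda>x. c) x = 0"
  by (rule grad_eqI) simp

lemma difference_quotient_tendsto:
  assumes "(v has_derivative (\<lambda>h. p \<bullet> h)) (at x)"
  shows "((\<lambda>t. (v (x + t *\<^sub>R e) - v x) / t) \<longlongrightarrow> p \<bullet> e) (at 0)"
proof -
  have v: "(v has_derivative (\<lambda>h. p \<bullet> h)) (at (x + 0 *\<^sub>R e))" using assms by simp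
  have "((\<lambda>t. x + t *\<^sub>R e) has_derivative (\<lambda>t. t *\<^sub>R e)) (at 0)"
    by (auto intro!: derivative_eq_intros)
  from has_derivative_compose[OF this v]
  have "((\<lambda>t. v (x + t *\<^sub>R e)) has_derivative (\<lambda>t. p \<bullet> e * t)) (at 0)" by (simp add: mult.commute)
  then have "((\<lambda>t. v (x + t *\<^sub>R e)) has_real_derivative p \<bullet> e) (at 0)"
    by (simp add: has_field_derivative_def)
  then show ?thesis by (simp add: DERIV_def)
qed

lemma difference_quotient_LIMSEQ:
  assumes "v differentiable (at x)"
  shows "(\<lambda>k. real (Suc k) * (v (x + inverse (real (Suc k)) *\<^sub>R e) - v x)) \<longlonglongrightarrow> grad v x \<bullet> e"
proof -
  have "filterlim (\<lambda>k. inverse (real (Suc k))) (at 0) sequentially"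
    using LIMSEQ_inverse_real_of_nat by (simp add: filterlim_at)
  from filterlim_compose[OF difference_quotient_tendsto[OF has_derivative_grad[OF assms]] this]
  show ?thesis by (simp add: divide_inverse mult.commute)
qed

text \<open>Test the difference quotient in the direction of the gradient itself.\<close>

lemma norm_grad_le:
  assumes "L-lipschitz_on UNIV v" "v differentiable (at x)"
  shows "norm (grad v x) \<le> L"
proof -
  let ?p = "grad v x"
  have "((\<lambda>t. \<bar>(v (x + t *\<^sub>R ?p) - v x) / t\<bar>) \<longlongrightarrow> \<bar>?p \<bullet> ?p\<bar>) (at 0)"
    by (intro tendsto_rabs difference_quotient_tendsto has_derivative_grad assms)
  moreover have "eventually (\<lambda>t. \<bar>(v (x + t *\<^sub>R ?p) - v x) / t\<bar> \<le> L * norm ?p) (at 0)"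
  proof (rule eventually_mono[OF eventually_neq_at_within[of 0]])
    fix t :: real assume "t \<noteq> 0"
    moreover have "\<bar>v (x + t *\<^sub>R ?p) - v x\<bar> \<le> L * norm ?p * \<bar>t\<bar>"
      using lipschitz_onD[OF assms(1), of "x + t *\<^sub>R ?p" x] by (simp add: dist_norm mult_ac)
    ultimately show "\<bar>(v (x + t *\<^sub>R ?p) - v x) / t\<bar> \<le> L * norm ?p" by (simp add: abs_divide field_simps)
  qed
  ultimately have "\<bar>?p \<bullet> ?p\<bar> \<le> L * norm ?p" by (rule tendsto_upperbound) simp
  then have "norm ?p * norm ?p \<le> L * norm ?p" by (simp add: power2_eq_square[symmetric] dot_square_norm)
  then show ?thesis using lipschitz_on_nonneg[OF assms(1)]
    by (cases "norm ?p = 0") auto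
qed

lemma borel_measurable_lebesgue_spike:
  fixes f g :: "'a::euclidean_space \<Rightarrow> 'b::topological_space"
  assumes g: "g \<in> borel_measurable lebesgue" and N: "negligible {x. f x \<noteq> g x}"
  shows "f \<in> borel_measurable lebesgue"
proof (rule measurableI)
  fix A :: "'b set" assume A: "A \<in> sets borel"
  let ?N = "{x. f x \<noteq> g x}"
  have eq: "f -` A = (g -` A - ?N) \<union> (f -` A \<inter> ?N)" by auto
  have N': "?N \<in> sets lebesgue" using N by (simp add: negligible_iff_null_sets null_sets_def)
  have "negligible (f -` A \<inter> ?N)" by (rule negligible_subset[OF N]) auto
  then have "f -` A \<inter> ?N \<in> sets lebesgue" by (simp add: negligible_iff_null_sets null_sets_def)
  moreover have "g -` A \<in> sets lebesgue" using measurable_sets[OF g A] by simp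
  ultimately have "f -` A \<in> sets lebesgue"
    by (subst eq) (intro sets.Un sets.Diff N')
  then show "f -` A \<inter> space lebesgue \<in> sets lebesgue" by simp
qed simp

lemma AE_lebesgue_if_negligible:
  assumes "negligible {x. \<not> P x}"
  shows "AE x in lebesgue. P x"
  using assms by (intro AE_I'[of "{x. \<not> P x}"]) (auto simp: negligible_iff_null_sets)

text \<open>\<open>grad\<close> is an arbitrary choice where \<open>v\<close> is not differentiable,
  but this set is null and Lebesgue measure is complete; elsewhere each component is a limit of
  continuous difference quotients.\<close>

lemma borel_measurable_grad:
  fixes v :: "real^'n \<Rightarrow> real"
  assumes v: "L-lipschitz_on UNIV v"
  shows "grad v \<in> borel_measurable lebesgue"
proof (rule borel_measurable_euclidean_space[THEN iffD2], rule ballI)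
  fix e :: "real^'n"
  define s where "s k x = real (Suc k) * (v (x + inverse (real (Suc k)) *\<^sub>R e) - v x)" for k x
  have "continuous_on UNIV (s k)" for k
    unfolding s_def by (intro continuous_intros continuous_on_compose2[OF lipschitz_on_continuous_on[OF v]]) auto
  then have s: "s k \<in> borel_measurable lborel" for k
    by (simp add: borel_measurable_continuous_onI)
  have lim: "(\<lambda>x. lim (\<lambda>k. s k x)) \<in> borel_measurable lebesgue"
    by (intro measurable_completion borel_measurable_lim_metric s)
  have "grad v x \<bullet> e = lim (\<lambda>k. s k x)" if "v differentiable (at x)" for x
    using limI[OF difference_quotient_LIMSEQ[OF that, of e]] unfolding s_def ..
  then have "{x. grad v x \<bullet> e \<noteq> lim (\<lambda>k. s k x)} \<subseteq> {x. \<not> v differentiable (at x)}" by auto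
  then show "(\<lambda>x. grad v x \<bullet> e) \<in> borel_measurable lebesgue"
    by (intro borel_measurable_lebesgue_spike[OF lim] negligible_subset[OF rademacher[OF v]])
qed

lemma integral_translation:
  fixes h :: "real^'n \<Rightarrow> real"
  assumes "h \<in> borel_measurable borel"
  shows "(LINT x|lborel. h (x + c)) = (LINT x|lborel. h x)"
    and "integrable lborel h \<Longrightarrow> integrable lborel (\<lambda>x. h (x + c))"
proof -
  show "(LINT x|lborel. h (x + c)) = (LINT x|lborel. h x)"
    using integral_distr[of "(+) c" lborel borel h] assms by (simp add: lborel_distr_plus add.commute)
  show "integrable lborel h \<Longrightarrow> integrable lborel (\<lambda>x. h (x + c))"
    using integrable_distr_eq[of "(+) c" lborel borel h] assms by (simp add: lborel_distr_plus add.commute)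
qed

text \<open>Difference quotients with steps 1/(k+1) integrate to zero by translation invariance; the
  Lipschitz bound gives a majorant and Rademacher's theorem the limit almost everywhere.\<close>

lemma integral_grad_eq_0:
  fixes h :: "real^'n \<Rightarrow> real"
  assumes h: "L-lipschitz_on UNIV h" and supp: "\<And>x. x \<notin> cball x0 R \<Longrightarrow> h x = 0"
  shows "integrable lebesgue (\<lambda>x. grad h x \<bullet> e)" "(LINT x|lebesgue. grad h x \<bullet> e) = 0"
proof -
  have ch: "continuous_on UNIV h" using h by (rule lipschitz_on_continuous_on)
  then have hm [measurable]: "h \<in> borel_measurable borel" by (rule borel_measurable_continuous_onI)
  have ih: "integrable lborel h"
  proof -
    have "integrable lborel (\<lambda>x. indicator (cball x0 R) x *\<^sub>R h x)"
      by (rule borel_integrable_compact) (auto intro: continuous_on_subset[OF ch])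
    then show ?thesis by (rule back_subst[where P = "integrable lborel"]) (auto simp: fun_eq_iff indicator_def supp)
  qed
  define s where "s k x = real (Suc k) * (h (x + inverse (real (Suc k)) *\<^sub>R e) - h x)" for k x
  \<comment> \<open>The translations have length at most \<open>norm e\<close>, so the quotients
    live in the ball enlarged by \<open>norm e\<close>.\<close>
  define w where "w x = indicator (cball x0 (R + norm e)) x *\<^sub>R (L * norm e)" for x
  have sm: "s k \<in> borel_measurable borel" for k unfolding s_def by measurable
  have s0: "(LINT x|lebesgue. s k x) = 0" for k
  proof -
    have "(LINT x|lebesgue. s k x) = (LINT x|lborel. s k x)" by (rule integral_completion) (use sm in simp)
    also have "\<dots> = 0"
      unfolding s_def using ih integral_translation[OF hm] by simp
    finally show ?thesis .
  qed
  have bound: "norm (s k x) \<le> w x" for k x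
  proof (cases "x \<in> cball x0 (R + norm e)")
    case True
    have "\<bar>h (x + inverse (real (Suc k)) *\<^sub>R e) - h x\<bar> \<le> L * (inverse (real (Suc k)) * norm e)"
      using lipschitz_onD[OF h, of "x + inverse (real (Suc k)) *\<^sub>R e" x] by (simp add: dist_norm)
    from mult_left_mono[OF this, of "real (Suc k)"]
    have "\<bar>s k x\<bar> \<le> real (Suc k) * (L * (inverse (real (Suc k)) * norm e))"
      by (simp add: s_def abs_mult)
    also have "\<dots> = L * norm e" by (simp add: field_simps)
    finally have "\<bar>s k x\<bar> \<le> L * norm e" .
    then show ?thesis using True by (simp add: w_def)
  next
    case False
    have "x \<notin> cball x0 R" using False by auto (smt (verit) norm_ge_zero)
    moreover have "x + inverse (real (Suc k)) *\<^sub>R e \<notin> cball x0 R"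
    proof
      assume "x + inverse (real (Suc k)) *\<^sub>R e \<in> cball x0 R"
      moreover have "dist x (x + inverse (real (Suc k)) *\<^sub>R e) \<le> norm e"
        by (simp add: dist_norm field_simps mult_left_le_one_le)
      ultimately have "dist x0 x \<le> R + norm e"
        using dist_triangle2[of x0 x "x + inverse (real (Suc k)) *\<^sub>R e"] by (simp add: dist_commute)
      then show False using False by simp
    qed
    ultimately show ?thesis using False by (simp add: s_def supp w_def)
  qed
  have gm: "(\<lambda>x. grad h x \<bullet> e) \<in> borel_measurable lebesgue"
    using borel_measurable_grad[OF h] by (intro borel_measurable_inner) auto
  have sm': "s k \<in> borel_measurable lebesgue" for k
    using sm by (simp add: measurable_completion)
  have iw: "integrable lebesgue w"
    unfolding w_def by (intro integrable_completion[THEN iffD2] borel_integrable_compact)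
      (auto intro!: measurable_If borel_measurable_times borel_measurable_indicator)
  have lim: "AE x in lebesgue. (\<lambda>k. s k x) \<longlonglongrightarrow> grad h x \<bullet> e"
    by (intro AE_lebesgue_if_negligible negligible_subset[OF rademacher[OF h]])
       (auto simp: s_def dest: difference_quotient_LIMSEQ)
  note dc = gm sm' iw lim AE_I2[OF bound]
  show "integrable lebesgue (\<lambda>x. grad h x \<bullet> e)" by (rule integrable_dominated_convergence[OF dc])
  have "(\<lambda>k. LINT x|lebesgue. s k x) \<longlonglongrightarrow> (LINT x|lebesgue. grad h x \<bullet> e)"
    by (rule integral_dominated_convergence[OF dc])
  then show "(LINT x|lebesgue. grad h x \<bullet> e) = 0" by (simp add: s0 LIMSEQ_const_iff)
qed

lemma integrable_lebesgue_if_lborel: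
  fixes f :: "'a::euclidean_space \<Rightarrow> real"
  shows "integrable lborel f \<Longrightarrow> integrable lebesgue f"
  using integrable_completion[of f lborel] by auto

lemma set_integrable_continuous_compact:
  fixes f :: "real^'n \<Rightarrow> real"
  assumes "compact K" "continuous_on K f"
  shows "set_integrable lebesgue K f"
  unfolding set_integrable_def
  using borel_integrable_compact[OF assms] by (rule integrable_lebesgue_if_lborel)

lemma AE_norm_grad_le:
  assumes "L-lipschitz_on UNIV v"
  shows "AE x in lebesgue. norm (grad v x) \<le> L"
  by (intro AE_lebesgue_if_negligible negligible_subset[OF rademacher[OF assms]])
     (auto dest: norm_grad_le[OF assms])

lemma set_integrable_inner_grad:
  fixes v :: "real^'n \<Rightarrow> real"
  assumes v: "L-lipschitz_on UNIV v" and K: "compact K" and P: "continuous_on K P"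
  shows "set_integrable lebesgue K (\<lambda>x. P x \<bullet> grad v x)"
proof -
  obtain B where B: "\<And>x. x \<in> K \<Longrightarrow> norm (P x) \<le> B"
    using compact_imp_bounded[OF compact_continuous_image[OF P K]] by (auto simp: bounded_iff)
  have Pm: "(\<lambda>x. indicator K x *\<^sub>R P x) \<in> borel_measurable lebesgue"
    using borel_measurable_continuous_on_indicator[OF _ P] K
    by (auto intro!: measurable_completion simp: compact_imp_closed)
  have "integrable lebesgue (\<lambda>x. (indicator K x *\<^sub>R P x) \<bullet> grad v x)"
  proof (rule Bochner_Integration.integrable_bound)
    show "integrable lebesgue (\<lambda>x. indicator K x *\<^sub>R (\<bar>B\<bar> * L))"
      using set_integrable_continuous_compact[OF K continuous_on_const] by (simp add: set_integrable_def)
    show "(\<lambda>x. (indicator K x *\<^sub>R P x) \<bullet> grad v x) \<in> borel_measurable lebesgue"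
      by (intro borel_measurable_inner Pm borel_measurable_grad[OF v])
    show "AE x in lebesgue. norm ((indicator K x *\<^sub>R P x) \<bullet> grad v x) \<le> norm (indicator K x *\<^sub>R (\<bar>B\<bar> * L))"
    proof (rule eventually_mono[OF AE_norm_grad_le[OF v]])
      fix x assume g: "norm (grad v x) \<le> L"
      have "\<bar>P x \<bullet> grad v x\<bar> \<le> \<bar>B\<bar> * L" if "x \<in> K"
      proof -
        have "\<bar>P x \<bullet> grad v x\<bar> \<le> norm (P x) * norm (grad v x)" by (rule Cauchy_Schwarz_ineq2)
        also have "\<dots> \<le> \<bar>B\<bar> * L" using B[OF that] g by (intro mult_mono) auto
        finally show ?thesis .
      qed
      then show "norm ((indicator K x *\<^sub>R P x) \<bullet> grad v x) \<le> norm (indicator K x *\<^sub>R (\<bar>B\<bar> * L))"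
        by (auto simp: indicator_def)
    qed
  qed
  then show ?thesis by (simp add: set_integrable_def)
qed

lemma lipschitz_on_mult_compact:
  fixes f g :: "'a::metric_space \<Rightarrow> real"
  assumes K: "compact K" and f: "A-lipschitz_on K f" and g: "B-lipschitz_on K g"
  shows "\<exists>C. C-lipschitz_on K (\<lambda>x. f x * g x)"
proof -
  obtain F where F: "\<And>x. x \<in> K \<Longrightarrow> \<bar>f x\<bar> \<le> F"
    using compact_imp_bounded[OF compact_continuous_image[OF lipschitz_on_continuous_on[OF f] K]] by (auto simp: bounded_iff)
  obtain G where G: "\<And>x. x \<in> K \<Longrightarrow> \<bar>g x\<bar> \<le> G"
    using compact_imp_bounded[OF compact_continuous_image[OF lipschitz_on_continuous_on[OF g] K]] by (auto simp: bounded_iff)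
  have AB: "A \<ge> 0" "B \<ge> 0" using f g by (auto dest: lipschitz_on_nonneg)
  have "(\<bar>F\<bar> * B + \<bar>G\<bar> * A)-lipschitz_on K (\<lambda>x. f x * g x)"
  proof (rule lipschitz_onI)
    fix x y assume xy: "x \<in> K" "y \<in> K"
    have "\<bar>f x * g x - f y * g y\<bar> = \<bar>f x * (g x - g y) + g y * (f x - f y)\<bar>" by (simp add: algebra_simps)
    also have "\<dots> \<le> \<bar>f x\<bar> * \<bar>g x - g y\<bar> + \<bar>g y\<bar> * \<bar>f x - f y\<bar>"
      by (metis abs_mult abs_triangle_ineq)
    also have "\<dots> \<le> \<bar>F\<bar> * (B * dist x y) + \<bar>G\<bar> * (A * dist x y)"
      using F[OF xy(1)] G[OF xy(2)] lipschitz_onD[OF f xy] lipschitz_onD[OF g xy]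
      by (intro add_mono mult_mono) (auto simp: dist_real_def)
    finally show "dist (f x * g x) (f y * g y) \<le> (\<bar>F\<bar> * B + \<bar>G\<bar> * A) * dist x y"
      by (simp add: dist_real_def algebra_simps)
  qed (use AB in auto)
  then show ?thesis by blast
qed

text \<open>Apply \<open>integral_grad_eq_0\<close> to each component of \<eta> P in its own basis
  direction and sum. Since \<rho> < r, \<eta> vanishes on the sphere, so extension by zero keeps the
  components Lipschitz on the whole space.\<close>

lemma integration_by_parts:
  fixes \<eta> :: "real^'n \<Rightarrow> real" and P :: "real^'n \<Rightarrow> real^'n"
  assumes \<eta>: "L-lipschitz_on UNIV \<eta>" and supp: "\<And>x. x \<notin> cball x0 \<rho> \<Longrightarrow> \<eta> x = 0" and \<rho>: "\<rho> < r"
    and P: "\<And>x. x \<in> cball x0 r \<Longrightarrow> (P has_derivative P' x) (at x)"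
    and PL: "B-lipschitz_on (cball x0 r) P"
    and D: "\<And>x. x \<in> cball x0 r \<Longrightarrow> D x = (\<Sum>b\<in>Basis. P' x b \<bullet> b)" "continuous_on (cball x0 r) D"
  shows "(LINT x:cball x0 r|lebesgue. P x \<bullet> grad \<eta> x) = - (LINT x:cball x0 r|lebesgue. \<eta> x * D x)"
proof -
  let ?K = "cball x0 r"
  have c\<eta>: "continuous_on UNIV \<eta>" using \<eta> by (rule lipschitz_on_continuous_on)
  have cP: "continuous_on ?K P" using PL by (rule lipschitz_on_continuous_on)
  define h where "h b x = (if x \<in> ?K then \<eta> x * (P x \<bullet> b) else 0)" for b x
  have lip: "\<exists>C. C-lipschitz_on UNIV (h b)" for b
  proof -
    have "(B * norm b)-lipschitz_on ?K (\<lambda>x. P x \<bullet> b)"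
    proof (rule lipschitz_onI)
      fix x y assume xy: "x \<in> ?K" "y \<in> ?K"
      have "\<bar>(P x - P y) \<bullet> b\<bar> \<le> norm (P x - P y) * norm b" by (rule Cauchy_Schwarz_ineq2)
      also have "\<dots> \<le> B * dist x y * norm b"
        using lipschitz_onD[OF PL xy] by (intro mult_right_mono) (auto simp: dist_norm)
      finally show "dist (P x \<bullet> b) (P y \<bullet> b) \<le> B * norm b * dist x y"
        by (simp add: dist_real_def inner_diff_left mult_ac)
    qed (use lipschitz_on_nonneg[OF PL] in auto)
    then obtain C where C: "C-lipschitz_on ?K (\<lambda>x. \<eta> x * (P x \<bullet> b))"
      using lipschitz_on_mult_compact[OF compact_cball lipschitz_on_subset[OF \<eta> subset_UNIV]] by blast
    have "C-lipschitz_on UNIV (h b)"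
      unfolding h_def using \<rho> by (intro lipschitz_on_zero_extension C) (auto simp: supp)
    then show ?thesis ..
  qed
  have h0: "h b x = 0" if "x \<notin> ?K" for b x using that by (simp add: h_def)
  have int0: "integrable lebesgue (\<lambda>x. grad (h b) x \<bullet> b)" "(LINT x|lebesgue. grad (h b) x \<bullet> b) = 0" for b
    using lip[of b] integral_grad_eq_0[of _ "h b" x0 r b] h0[of _ b] by blast+
  \<comment> \<open>Off the sphere the case split in \<open>h b\<close> is the same in a whole
    neighbourhood; the sphere itself is null and left out.\<close>
  have gr: "(\<Sum>b\<in>Basis. grad (h b) x \<bullet> b) = indicator ?K x *\<^sub>R (P x \<bullet> grad \<eta> x) + indicator ?K x *\<^sub>R (\<eta> x * D x)"
    if x: "x \<notin> sphere x0 r" and d: "\<eta> differentiable (at x)" for x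
  proof (cases "x \<in> ?K")
    case False
    have "grad (h b) x = grad (\<lambda>x. 0) x" for b
      by (rule grad_cong_open[of "- ?K"]) (use False h0 in auto)
    then show ?thesis using False by simp
  next
    case True
    then have xb: "x \<in> ball x0 r" using x by auto
    have "grad (h b) x \<bullet> b = (grad \<eta> x \<bullet> b) * (P x \<bullet> b) + \<eta> x * (P' x b \<bullet> b)" for b
    proof -
      have "((\<lambda>y. \<eta> y * (P y \<bullet> b)) has_derivative (\<lambda>v. (grad \<eta> x \<bullet> v) * (P x \<bullet> b) + \<eta> x * (P' x v \<bullet> b))) (at x)"
        using has_derivative_grad[OF d] P[OF True]
        by (auto intro!: derivative_eq_intros simp: algebra_simps)
      then have hd: "(h b has_derivative (\<lambda>v. (grad \<eta> x \<bullet> v) * (P x \<bullet> b) + \<eta> x * (P' x v \<bullet> b))) (at x)"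
        by (rule has_derivative_transform_within_open[OF _ open_ball xb]) (simp add: h_def)
      then have "(h b has_derivative (\<lambda>v. grad (h b) x \<bullet> v)) (at x)"
        by (intro has_derivative_grad differentiableI)
      from has_derivative_unique[OF this hd] show ?thesis by metis
    qed
    then have "(\<Sum>b\<in>Basis. grad (h b) x \<bullet> b)
        = (\<Sum>b\<in>Basis. (P x \<bullet> b) * (grad \<eta> x \<bullet> b)) + \<eta> x * (\<Sum>b\<in>Basis. P' x b \<bullet> b)"
      by (simp add: sum.distrib sum_distrib_left mult.commute)
    also have "(\<Sum>b\<in>Basis. (P x \<bullet> b) * (grad \<eta> x \<bullet> b)) = P x \<bullet> grad \<eta> x"
      by (rule euclidean_inner[symmetric])
    finally show ?thesis using True D(1)[OF True] by simp
  qed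
  have neg: "negligible (sphere x0 r \<union> {x. \<not> \<eta> differentiable (at x)})"
    by (intro negligible_Un rademacher[OF \<eta>] negligible_sphere)
  have i1: "integrable lebesgue (\<lambda>x. indicator ?K x *\<^sub>R (P x \<bullet> grad \<eta> x))"
    using set_integrable_inner_grad[OF \<eta> compact_cball cP] by (simp add: set_integrable_def)
  have i2: "integrable lebesgue (\<lambda>x. indicator ?K x *\<^sub>R (\<eta> x * D x))"
    using set_integrable_continuous_compact[OF compact_cball continuous_on_mult[OF continuous_on_subset[OF c\<eta> subset_UNIV] D(2)]]
    by (simp add: set_integrable_def)
  have "0 = (LINT x|lebesgue. (\<Sum>b\<in>Basis. grad (h b) x \<bullet> b))"
    using int0 by (subst Bochner_Integration.integral_sum) auto
  also have "\<dots> = (LINT x|lebesgue. indicator ?K x *\<^sub>R (P x \<bullet> grad \<eta> x) + indicator ?K x *\<^sub>R (\<eta> x * D x))"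
  proof (rule integral_cong_AE)
    show "(\<lambda>x. \<Sum>b\<in>Basis. grad (h b) x \<bullet> b) \<in> borel_measurable lebesgue"
      using int0(1) by (intro borel_measurable_sum borel_measurable_integrable)
    show "(\<lambda>x. indicator ?K x *\<^sub>R (P x \<bullet> grad \<eta> x) + indicator ?K x *\<^sub>R (\<eta> x * D x)) \<in> borel_measurable lebesgue"
      by (intro borel_measurable_integrable Bochner_Integration.integrable_add i1 i2)
    show "AE x in lebesgue. (\<Sum>b\<in>Basis. grad (h b) x \<bullet> b) =
        indicator ?K x *\<^sub>R (P x \<bullet> grad \<eta> x) + indicator ?K x *\<^sub>R (\<eta> x * D x)"
      by (intro AE_lebesgue_if_negligible negligible_subset[OF neg]) (use gr in blast)
  qed
  also have "\<dots> = (LINT x:?K|lebesgue. P x \<bullet> grad \<eta> x) + (LINT x:?K|lebesgue. \<eta> x * D x)"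
    unfolding set_lebesgue_integral_def using i1 i2 by (rule Bochner_Integration.integral_add)
  finally show ?thesis by simp
qed

section \<open>Lipschitz functions with zero boundary values and their energy\<close>

lemma W1inf0_zero_extension:
  assumes "v \<in> W1inf0 \<Omega>"
  obtains L where "L-lipschitz_on UNIV (\<lambda>x. if x \<in> closure \<Omega> then v x else 0)"
proof -
  obtain L where "L-lipschitz_on (closure \<Omega>) v" "\<And>x. x \<in> frontier \<Omega> \<Longrightarrow> v x = 0"
    using assms by (auto simp: W1inf0_def)
  then have "L-lipschitz_on UNIV (\<lambda>x. if x \<in> closure \<Omega> then v x else 0)"
    using interior_mono[OF closure_subset, of \<Omega>]
    by (intro lipschitz_on_zero_extension) (auto simp: frontier_def)
  then show thesis by (rule that)
qed

text \<open>Nothing is known about \<open>v\<close> outside the closure, so Rademacher's theorem and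
  measurability are applied to its zero extension, which has the same gradient on the open set
  \<open>\<Omega>\<close>.\<close>

lemma W1inf0_grad:
  fixes \<Omega> :: "(real^'n) set"
  assumes v: "v \<in> W1inf0 \<Omega>" and \<Omega>: "open \<Omega>"
  shows "negligible {x \<in> \<Omega>. \<not> v differentiable (at x)}"
    and "\<exists>g L. g \<in> borel_measurable lebesgue \<and> (\<forall>x\<in>\<Omega>. grad v x = g x) \<and> (AE x in lebesgue. norm (g x) \<le> L)"
proof -
  let ?v = "\<lambda>x. if x \<in> closure \<Omega> then v x else 0"
  obtain L where L: "L-lipschitz_on UNIV ?v" using v by (rule W1inf0_zero_extension)
  have eq: "?v x = v x" if "x \<in> \<Omega>" for x using that closure_subset by auto
  have "v differentiable (at x)" if "?v differentiable (at x)" "x \<in> \<Omega>" for x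
    using that(1) has_derivative_transform_within_open[OF _ \<Omega> that(2), of ?v _ UNIV v] eq
    unfolding differentiable_def by blast
  then show "negligible {x \<in> \<Omega>. \<not> v differentiable (at x)}"
    by (intro negligible_subset[OF rademacher[OF L]]) blast
  have "grad v x = grad ?v x" if "x \<in> \<Omega>" for x
    by (rule grad_cong_open[OF \<Omega> that]) (simp add: eq)
  then show "\<exists>g L. g \<in> borel_measurable lebesgue \<and> (\<forall>x\<in>\<Omega>. grad v x = g x) \<and> (AE x in lebesgue. norm (g x) \<le> L)"
    using borel_measurable_grad[OF L] AE_norm_grad_le[OF L] by blast
qed

lemma energy_density_integrable:
  fixes \<Omega> :: "(real^'n) set"
  assumes v: "v \<in> W1inf0 \<Omega>" and \<Omega>: "open \<Omega>" "bounded \<Omega>" and f: "continuous_on {0..} f"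
  shows "set_integrable lebesgue \<Omega> (\<lambda>x. f (norm (grad v x)) - \<kappa> * v x)"
proof -
  have \<Omega>m: "\<Omega> \<in> sets lebesgue" using \<Omega> by simp
  have fin: "set_integrable lebesgue \<Omega> (\<lambda>x. C::real)" for C
  proof -
    have "set_integrable lebesgue (closure \<Omega>) (\<lambda>x. C)"
      using \<Omega> by (intro set_integrable_continuous_compact) auto
    then show ?thesis by (rule set_integrable_subset) (use \<Omega>m closure_subset in auto)
  qed
  have "set_integrable lebesgue (closure \<Omega>) (\<lambda>x. \<kappa> * v x)"
  proof (rule set_integrable_continuous_compact)
    show "continuous_on (closure \<Omega>) (\<lambda>x. \<kappa> * v x)"
      using v by (auto simp: W1inf0_def intro!: continuous_intros dest: lipschitz_on_continuous_on)
  qed (use \<Omega> in auto)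
  then have 1: "set_integrable lebesgue \<Omega> (\<lambda>x. \<kappa> * v x)"
    by (rule set_integrable_subset) (use \<Omega>m closure_subset in auto)
  obtain g L where g: "g \<in> borel_measurable lebesgue" "\<And>x. x \<in> \<Omega> \<Longrightarrow> grad v x = g x"
    "AE x in lebesgue. norm (g x) \<le> L" using W1inf0_grad(2)[OF v \<Omega>(1)] by blast
  have "bounded (f ` {0..L})"
    by (intro compact_imp_bounded compact_continuous_image continuous_on_subset[OF f]) auto
  then obtain C where C: "\<And>s. 0 \<le> s \<Longrightarrow> s \<le> L \<Longrightarrow> \<bar>f s\<bar> \<le> C"
    unfolding bounded_iff by (metis atLeastAtMost_iff imageI real_norm_def)
  \<comment> \<open>\<open>f\<close> is arbitrary on the negative axis; the truncation is continuous
    everywhere and does not change the values at norms.\<close>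
  have "continuous_on UNIV (\<lambda>s. f (max 0 s))"
    by (intro continuous_on_compose2[OF f] continuous_intros) auto
  then have "(\<lambda>s. f (max 0 s)) \<in> borel_measurable borel" by (rule borel_measurable_continuous_onI)
  then have "(\<lambda>x. f (max 0 (norm (g x)))) \<in> borel_measurable lebesgue"
    by (rule measurable_compose[OF measurable_compose[OF g(1) borel_measurable_norm]])
  then have fm: "(\<lambda>x. f (norm (g x))) \<in> borel_measurable lebesgue" by simp
  have "integrable lebesgue (\<lambda>x. indicator \<Omega> x *\<^sub>R f (norm (g x)))"
  proof (rule Bochner_Integration.integrable_bound)
    show "integrable lebesgue (\<lambda>x. indicator \<Omega> x *\<^sub>R C)" using fin by (simp add: set_integrable_def)
    show "(\<lambda>x. indicator \<Omega> x *\<^sub>R f (norm (g x))) \<in> borel_measurable lebesgue"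
      using fm \<Omega>m by (intro borel_measurable_scaleR borel_measurable_indicator)
    show "AE x in lebesgue. norm (indicator \<Omega> x *\<^sub>R f (norm (g x))) \<le> norm (indicator \<Omega> x *\<^sub>R C)"
    proof (rule eventually_mono[OF g(3)])
      fix x assume "norm (g x) \<le> L"
      then have "\<bar>f (norm (g x))\<bar> \<le> \<bar>C\<bar>" using C[of "norm (g x)"] by simp
      then show "norm (indicator \<Omega> x *\<^sub>R f (norm (g x))) \<le> norm (indicator \<Omega> x *\<^sub>R C)"
        by (simp add: indicator_def)
    qed
  qed
  then have "integrable lebesgue (\<lambda>x. indicator \<Omega> x *\<^sub>R f (norm (grad v x)))"
    by (rule back_subst[where P = "integrable lebesgue"]) (auto simp: fun_eq_iff indicator_def g(2))
  then have "set_integrable lebesgue \<Omega> (\<lambda>x. f (norm (grad v x)))" by (simp add: set_integrable_def)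
  then show ?thesis using 1 by (rule set_integral_diff)
qed

section \<open>Comparison with test functions\<close>

text \<open>The push-forward under \<open>g\<close> of Lebesgue measure on \<open>K\<close> is
  finite, so it has only countably many atoms, while the interval is uncountable.\<close>

lemma ex_negligible_level_set:
  fixes g :: "'a::euclidean_space \<Rightarrow> real"
  assumes K: "compact K" and g: "continuous_on K g" and ab: "a < b"
  shows "\<exists>\<delta>. a < \<delta> \<and> \<delta> < b \<and> negligible {x \<in> K. g x = \<delta>}"
proof -
  have Kb: "K \<in> sets borel" using K by (simp add: compact_imp_closed borel_closed)
  define M where "M = restrict_space lborel K"
  have gm: "g \<in> borel_measurable M"
  proof -
    have "sets M = sets (restrict_space borel K)"
      unfolding M_def by (rule sets_restrict_space_cong) simp
    then show ?thesis
      using borel_measurable_continuous_on_restrict[OF g] measurable_cong_sets by blast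
  qed
  have emM: "emeasure M A = emeasure lborel A" if "A \<subseteq> K" "A \<in> sets borel" for A
    using that Kb by (simp add: M_def emeasure_restrict_space)
  have spM: "space M = K" by (simp add: M_def space_restrict_space)
  have fin: "finite_measure (distr M borel g)"
  proof (rule finite_measureI)
    have "emeasure (distr M borel g) UNIV = emeasure lborel K"
      using emM[of K] Kb gm by (simp add: emeasure_distr spM)
    also have "\<dots> < \<infinity>" using K by (intro emeasure_bounded_finite compact_imp_bounded)
    finally show "emeasure (distr M borel g) (space (distr M borel g)) \<noteq> \<infinity>" by simp
  qed
  have "countable {\<delta>. measure (distr M borel g) {\<delta>} \<noteq> 0}"
    by (rule finite_measure.countable_support[OF fin])
  moreover have "uncountable {a<..<b}" using ab by (simp add: uncountable_open_interval)
  ultimately have "\<not> {a<..<b} \<subseteq> {\<delta>. measure (distr M borel g) {\<delta>} \<noteq> 0}"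
    using countable_subset by blast
  then obtain \<delta> where \<delta>: "a < \<delta>" "\<delta> < b" "measure (distr M borel g) {\<delta>} = 0" by auto
  have eq: "g -` {\<delta>} \<inter> space M = {x \<in> K. g x = \<delta>}" by (auto simp: spM)
  have cl: "closed {x \<in> K. g x = \<delta>}"
    using continuous_closed_preimage[OF g compact_imp_closed[OF K], of "{\<delta>}"]
    by (auto simp: vimage_def Int_def)
  have "emeasure (distr M borel g) {\<delta>} = 0"
    using \<delta>(3) by (simp add: finite_measure.emeasure_eq_measure[OF fin])
  then have "emeasure lborel {x \<in> K. g x = \<delta>} = 0"
    using emM[of "{x \<in> K. g x = \<delta>}"] cl gm by (simp add: emeasure_distr eq)
  then have "negligible {x \<in> K. g x = \<delta>}"
    using cl by (auto simp: negligible_iff_null_sets null_sets_def borel_closed)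
  then show ?thesis using \<delta> by blast
qed

lemma lipschitz_on_cball_if_C1:
  fixes \<phi> :: "'a::euclidean_space \<Rightarrow> real"
  assumes \<phi>: "\<And>x. x \<in> cball x0 r \<Longrightarrow> (\<phi> has_derivative (\<lambda>h. D\<phi> x \<bullet> h)) (at x)"
    and D\<phi>: "continuous_on (cball x0 r) D\<phi>"
  shows "\<exists>C. C-lipschitz_on (cball x0 r) \<phi>"
proof -
  have "bounded (D\<phi> ` cball x0 r)"
    by (intro compact_imp_bounded compact_continuous_image D\<phi>) auto
  then obtain C where C: "\<And>x. x \<in> cball x0 r \<Longrightarrow> norm (D\<phi> x) \<le> C"
    unfolding bounded_iff by (metis imageI)
  have "\<bar>C\<bar>-lipschitz_on (cball x0 r) \<phi>"
  proof (rule lipschitz_onI)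
    fix x y assume xy: "x \<in> cball x0 r" "y \<in> cball x0 r"
    have "norm (\<phi> x - \<phi> y) \<le> \<bar>C\<bar> * norm (x - y)"
    proof (rule differentiable_bound[where S = "cball x0 r", OF convex_cball _ _ xy(1,2)])
      fix z assume z: "z \<in> cball x0 r"
      show "(\<phi> has_derivative (\<lambda>h. D\<phi> z \<bullet> h)) (at z within cball x0 r)"
        using \<phi>[OF z] by (rule has_derivative_at_withinI)
      show "onorm (\<lambda>h. D\<phi> z \<bullet> h) \<le> \<bar>C\<bar>"
      proof (rule onorm_le)
        fix h
        have "norm (D\<phi> z \<bullet> h) \<le> norm (D\<phi> z) * norm h" by (simp add: Cauchy_Schwarz_ineq2)
        also have "\<dots> \<le> \<bar>C\<bar> * norm h" using C[OF z] by (intro mult_right_mono) auto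
        finally show "norm (D\<phi> z \<bullet> h) \<le> \<bar>C\<bar> * norm h" .
      qed
    qed
    then show "dist (\<phi> x) (\<phi> y) \<le> \<bar>C\<bar> * dist x y" by (simp add: dist_norm)
  qed simp
  then show ?thesis by blast
qed

text \<open>The competitor is the maximum of u and \<open>\<phi> + \<delta>\<close> near the contact point. The level \<open>\<delta>\<close> is
  chosen so that the set where \<open>u = \<phi> + \<delta>\<close> is null; the gradient of the competitor is unknown there.\<close>

lemma no_contact_from_below:
  fixes \<Omega> :: "(real^'n) set"
  assumes \<Omega>: "open \<Omega>" "bounded \<Omega>" and f: "continuous_on {0..} f"
    and u: "u \<in> W1inf0 \<Omega>"
    and umin: "\<And>v. v \<in> W1inf0 \<Omega> \<Longrightarrow>
      (LINT x:\<Omega>|lebesgue. f (norm (grad u x)) - \<kappa> * u x) \<le> (LINT x:\<Omega>|lebesgue. f (norm (grad v x)) - \<kappa> * v x)"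
    and \<phi>: "\<And>x. x \<in> \<Omega> \<Longrightarrow> (\<phi> has_derivative (\<lambda>h. D\<phi> x \<bullet> h)) (at x)" and D\<phi>: "continuous_on \<Omega> D\<phi>"
    and touch: "u x0 = \<phi> x0" "\<And>x. x \<in> \<Omega> \<Longrightarrow> x \<noteq> x0 \<Longrightarrow> \<phi> x < u x"
    and r: "r > 0" "cball x0 r \<subseteq> \<Omega>"
    and P: "continuous_on (cball x0 r) P"
    and conv: "\<And>x q. x \<in> cball x0 r \<Longrightarrow> f (norm (D\<phi> x)) + P x \<bullet> (q - D\<phi> x) \<le> f (norm q)"
    and weak: "\<And>\<eta> L. L-lipschitz_on UNIV \<eta> \<Longrightarrow> (\<And>x. 0 \<le> \<eta> x) \<Longrightarrow> (\<And>x. x \<notin> cball x0 (r/2) \<Longrightarrow> \<eta> x = 0) \<Longrightarrow>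
      (LINT x:cball x0 r|lebesgue. P x \<bullet> grad \<eta> x) \<le> c * (LINT x:cball x0 r|lebesgue. \<eta> x)"
    and c: "c < \<kappa>"
  shows False
proof -
  let ?K = "cball x0 r"
  obtain Lu where Lu: "Lu-lipschitz_on (closure \<Omega>) u" using u by (auto simp: W1inf0_def)
  have cu: "continuous_on (closure \<Omega>) u" using Lu by (rule lipschitz_on_continuous_on)
  have Kcl: "?K \<subseteq> closure \<Omega>" using r(2) closure_subset by auto
  obtain L\<phi> where L\<phi>: "L\<phi>-lipschitz_on ?K \<phi>"
    using lipschitz_on_cball_if_C1[of x0 r \<phi> D\<phi>] \<phi> r(2) continuous_on_subset[OF D\<phi> r(2)] by blast
  have c\<phi>: "continuous_on ?K \<phi>" using L\<phi> by (rule lipschitz_on_continuous_on)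
  have cd: "continuous_on ?K (\<lambda>x. u x - \<phi> x)"
    by (intro continuous_intros c\<phi> continuous_on_subset[OF cu Kcl])
  \<comment> \<open>Strict contact and compactness keep u - \<phi> above some m > 0 on the shell
    between the radii r/2 and r; a level below m confines \<eta> to the inner ball.\<close>
  have "\<exists>m>0. \<forall>x\<in>?K - ball x0 (r/2). m \<le> u x - \<phi> x"
  proof (cases "?K - ball x0 (r/2) = {}")
    case True
    then show ?thesis by (intro exI[of _ 1]) auto
  next
    case False
    have "compact (?K - ball x0 (r/2))" by (intro compact_diff) auto
    then obtain z where z: "z \<in> ?K - ball x0 (r/2)" "\<And>x. x \<in> ?K - ball x0 (r/2) \<Longrightarrow> u z - \<phi> z \<le> u x - \<phi> x"
      using continuous_attains_inf[OF _ False, of "\<lambda>x. u x - \<phi> x"] continuous_on_subset[OF cd] by blast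
    have "\<phi> z < u z" using z(1) r by (intro touch(2)) auto
    then show ?thesis using z(2) by (intro exI[of _ "u z - \<phi> z"]) auto
  qed
  then obtain m where m: "m > 0" "\<And>x. x \<in> ?K \<Longrightarrow> x \<notin> ball x0 (r/2) \<Longrightarrow> m \<le> u x - \<phi> x" by blast
  obtain \<delta> where \<delta>: "0 < \<delta>" "\<delta> < m" and Z: "negligible {x \<in> ?K. u x - \<phi> x = \<delta>}"
    using ex_negligible_level_set[OF compact_cball cd m(1)] by auto
  define \<eta> where "\<eta> x = (if x \<in> ?K then max 0 (\<phi> x + \<delta> - u x) else 0)" for x
  have \<eta>pos: "0 \<le> \<eta> x" for x by (simp add: \<eta>_def)
  have \<eta>supp: "\<eta> x = 0" if "x \<notin> ball x0 (r/2)" for x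
    using m(2)[of x] \<delta> that by (auto simp: \<eta>_def)
  have "(L\<phi> + Lu)-lipschitz_on ?K (\<lambda>x. max 0 (\<phi> x + \<delta> - u x))"
  proof (rule lipschitz_onI)
    fix x y assume xy: "x \<in> ?K" "y \<in> ?K"
    then have xy': "x \<in> closure \<Omega>" "y \<in> closure \<Omega>" using Kcl by blast+
    have "dist (max 0 (\<phi> x + \<delta> - u x)) (max 0 (\<phi> y + \<delta> - u y)) \<le> \<bar>\<phi> x - \<phi> y\<bar> + \<bar>u x - u y\<bar>"
      by (auto simp: dist_real_def max_def)
    also have "\<dots> \<le> L\<phi> * dist x y + Lu * dist x y"
      using lipschitz_onD[OF L\<phi> xy] lipschitz_onD[OF Lu xy'] by (simp add: dist_real_def)
    finally show "dist (max 0 (\<phi> x + \<delta> - u x)) (max 0 (\<phi> y + \<delta> - u y)) \<le> (L\<phi> + Lu) * dist x y"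
      by (simp add: algebra_simps)
  qed (use L\<phi> Lu in \<open>auto dest!: lipschitz_on_nonneg\<close>)
  then have \<eta>lip: "(L\<phi> + Lu)-lipschitz_on UNIV \<eta>"
    unfolding \<eta>_def
  proof (rule lipschitz_on_zero_extension[OF closed_cball])
    fix x assume "x \<in> frontier ?K"
    then have "x \<in> ?K" "x \<notin> ball x0 (r/2)" using r(1) by auto
    then show "max 0 (\<phi> x + \<delta> - u x) = 0" using \<eta>supp[of x] by (simp add: \<eta>_def)
  qed
  define w where "w x = u x + \<eta> x" for x
  have w: "w \<in> W1inf0 \<Omega>"
  proof -
    have "(Lu + (L\<phi> + Lu))-lipschitz_on (closure \<Omega>) w"
      unfolding w_def by (intro lipschitz_on_add Lu lipschitz_on_subset[OF \<eta>lip]) auto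
    moreover have "w x = 0" if "x \<in> frontier \<Omega>" for x
    proof -
      have "x \<notin> ?K" using that r(2) \<Omega>(1) by (auto simp: frontier_def interior_open)
      then show ?thesis using that u by (simp add: w_def \<eta>_def W1inf0_def)
    qed
    ultimately show ?thesis by (auto simp: W1inf0_def)
  qed
  have ub: "continuous_on (ball x0 r) (\<lambda>x. u x - \<phi> x)"
    by (rule continuous_on_subset[OF cd]) auto
  define A where "A = {x \<in> ball x0 r. u x - \<phi> x < \<delta>}"
  define A' where "A' = {x \<in> ball x0 r. \<delta> < u x - \<phi> x}"
  have oA: "open A"
    using continuous_open_preimage[OF ub open_ball, of "{..<\<delta>}"] by (auto simp: A_def vimage_def Int_def)
  have oA': "open A'"
    using continuous_open_preimage[OF ub open_ball, of "{\<delta><..}"] by (auto simp: A'_def vimage_def Int_def)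
  have x0A: "x0 \<in> A" using touch(1) r(1) \<delta>(1) by (simp add: A_def)
  have A\<Omega>: "x \<in> ?K" "x \<in> \<Omega>" if "x \<in> A" for x using that r(2) by (auto simp: A_def)
  \<comment> \<open>Off \<open>A\<close> and off the level set the competitor equals
    \<open>u\<close> in a whole neighbourhood, so the gradients agree even where \<open>u\<close> is
    not differentiable.\<close>
  have grad_out: "grad w x = grad u x" "grad \<eta> x = 0" "\<eta> x = 0"
    if x: "x \<notin> A" "x \<notin> {x \<in> ?K. u x - \<phi> x = \<delta>}" for x
  proof -
    have "\<exists>S. open S \<and> x \<in> S \<and> (\<forall>y\<in>S. \<eta> y = 0)"
    proof (cases "x \<in> cball x0 (r/2)")
      case True
      then have "x \<in> ball x0 r" using r(1) by auto
      then have "x \<in> A'" using x by (auto simp: A_def A'_def)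
      moreover have "\<eta> y = 0" if "y \<in> A'" for y using that by (auto simp: A'_def \<eta>_def)
      ultimately show ?thesis using oA' by blast
    next
      case False
      then show ?thesis using \<eta>supp by (intro exI[of _ "- cball x0 (r/2)"]) auto
    qed
    then obtain S where S: "open S" "x \<in> S" "\<And>y. y \<in> S \<Longrightarrow> \<eta> y = 0" by blast
    show "grad w x = grad u x" by (rule grad_cong_open[OF S(1,2)]) (simp add: w_def S(3))
    show "grad \<eta> x = 0" using grad_cong_open[OF S(1,2), of \<eta> "\<lambda>_. 0"] S(3) by simp
    show "\<eta> x = 0" using S by blast
  qed
  have grad_in: "grad w x = D\<phi> x" "u differentiable (at x) \<Longrightarrow> grad \<eta> x = D\<phi> x - grad u x" if x: "x \<in> A" for x
  proof -
    have eq: "\<eta> y = \<phi> y + \<delta> - u y" if "y \<in> A" for y using that by (auto simp: A_def \<eta>_def)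
    have d: "((\<lambda>y. \<phi> y + \<delta>) has_derivative (\<lambda>h. D\<phi> x \<bullet> h)) (at x)"
      using \<phi>[OF A\<Omega>(2)[OF x]] by (auto intro!: derivative_eq_intros)
    show "grad w x = D\<phi> x"
      by (rule grad_eqI, rule has_derivative_transform_within_open[OF d oA x]) (simp add: w_def eq)
    assume "u differentiable (at x)"
    then have "(u has_derivative (\<lambda>h. grad u x \<bullet> h)) (at x)" by (rule has_derivative_grad)
    from has_derivative_diff[OF d this]
    have d': "((\<lambda>y. \<phi> y + \<delta> - u y) has_derivative (\<lambda>h. (D\<phi> x - grad u x) \<bullet> h)) (at x)"
      by (simp add: inner_diff_left)
    show "grad \<eta> x = D\<phi> x - grad u x"
      by (rule grad_eqI, rule has_derivative_transform_within_open[OF d' oA x]) (simp add: eq)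
  qed
  let ?F = "\<lambda>v x. f (norm (grad v x)) - \<kappa> * v x"
  define R where "R x = indicator ?K x *\<^sub>R (P x \<bullet> grad \<eta> x) - \<kappa> * (indicator ?K x *\<^sub>R \<eta> x)" for x
  have iP: "integrable lebesgue (\<lambda>x. indicator ?K x *\<^sub>R (P x \<bullet> grad \<eta> x))"
    using set_integrable_inner_grad[OF \<eta>lip compact_cball P] by (simp add: set_integrable_def)
  have c\<eta>: "continuous_on UNIV \<eta>" using \<eta>lip by (rule lipschitz_on_continuous_on)
  have i\<eta>: "integrable lebesgue (\<lambda>x. indicator ?K x *\<^sub>R \<eta> x)"
    using set_integrable_continuous_compact[OF compact_cball continuous_on_subset[OF c\<eta> subset_UNIV]]
    by (simp add: set_integrable_def)
  have iF: "integrable lebesgue (\<lambda>x. indicator \<Omega> x *\<^sub>R ?F v x)" if "v \<in> W1inf0 \<Omega>" for v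
    using energy_density_integrable[OF that \<Omega> f, of \<kappa>] by (simp add: set_integrable_def)
  \<comment> \<open>The subgradient inequality at \<open>D\<phi> x\<close>, used with
    \<open>grad u x\<close> for \<open>q\<close>, bounds the pointwise change of energy by the flux
    term; differentiability of \<open>u\<close> makes the gradient of \<eta> the difference of the
    two gradients.\<close>
  have le: "indicator \<Omega> x *\<^sub>R ?F w x - indicator \<Omega> x *\<^sub>R ?F u x \<le> R x"
    if x: "x \<notin> {x \<in> ?K. u x - \<phi> x = \<delta>}" "x \<notin> {x \<in> \<Omega>. \<not> u differentiable (at x)}" for x
  proof (cases "x \<in> A")
    case True
    have "u differentiable (at x)" using x(2) A\<Omega>(2)[OF True] by simp
    note g = grad_in(1)[OF True] grad_in(2)[OF True this]
    have "f (norm (D\<phi> x)) - f (norm (grad u x)) \<le> P x \<bullet> (D\<phi> x - grad u x)"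
      using conv[OF A\<Omega>(1)[OF True], of "grad u x"] by (simp add: inner_diff_right)
    then show ?thesis using A\<Omega>[OF True] by (simp add: R_def g w_def algebra_simps)
  next
    case False
    note g = grad_out[OF False x(1)]
    then show ?thesis by (simp add: R_def w_def g)
  qed
  have "0 \<le> (LINT x:\<Omega>|lebesgue. ?F w x) - (LINT x:\<Omega>|lebesgue. ?F u x)"
    using umin[OF w] by simp
  also have "\<dots> = (LINT x|lebesgue. indicator \<Omega> x *\<^sub>R ?F w x - indicator \<Omega> x *\<^sub>R ?F u x)"
    unfolding set_lebesgue_integral_def
    by (rule Bochner_Integration.integral_diff[symmetric]) (intro iF w u)+
  also have "\<dots> \<le> (LINT x|lebesgue. R x)"
  proof (rule integral_mono_AE)
    show "integrable lebesgue R"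
      unfolding R_def by (intro Bochner_Integration.integrable_diff integrable_mult_right iP i\<eta>)
    show "AE x in lebesgue. indicator \<Omega> x *\<^sub>R ?F w x - indicator \<Omega> x *\<^sub>R ?F u x \<le> R x"
      by (intro AE_lebesgue_if_negligible negligible_subset[OF negligible_Un[OF Z W1inf0_grad(1)[OF u \<Omega>(1)]]])
         (use le in blast)
  qed (intro Bochner_Integration.integrable_diff iF w u)
  also have "\<dots> = (LINT x:?K|lebesgue. P x \<bullet> grad \<eta> x) - \<kappa> * (LINT x:?K|lebesgue. \<eta> x)"
    unfolding set_lebesgue_integral_def R_def
    using iP i\<eta> by (subst Bochner_Integration.integral_diff) auto
  also have "\<dots> \<le> (c - \<kappa>) * (LINT x:?K|lebesgue. \<eta> x)"
    using weak[OF \<eta>lip \<eta>pos] \<eta>supp by (auto simp: algebra_simps)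
  finally have "0 \<le> (c - \<kappa>) * (LINT x:?K|lebesgue. \<eta> x)" .
  \<comment> \<open>\<eta> equals \<delta> at the contact point, so it is at least \<delta>/2 on a
    small ball.\<close>
  moreover have "0 < (LINT x:?K|lebesgue. \<eta> x)"
  proof -
    have "\<eta> x0 = \<delta>" using touch(1) r(1) \<delta>(1) by (simp add: \<eta>_def)
    then obtain d where d: "d > 0" "\<And>x. dist x x0 < d \<Longrightarrow> dist (\<eta> x) \<delta> < \<delta>/2"
      using c\<eta> \<delta>(1) unfolding continuous_on_iff by (metis UNIV_I half_gt_zero)
    define s where "s = min d r"
    have s: "s > 0" using d(1) r(1) by (simp add: s_def)
    have "0 < \<delta>/2 * measure lebesgue (ball x0 s)"
      using \<delta>(1) content_ball_pos[OF s, of x0] by simp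
    also have "\<dots> = (LINT x|lebesgue. \<delta>/2 * indicator (ball x0 s) x)" by simp
    also have "\<dots> \<le> (LINT x|lebesgue. indicator ?K x *\<^sub>R \<eta> x)"
    proof (rule integral_mono)
      show "integrable lebesgue (\<lambda>x. \<delta>/2 * indicator (ball x0 s) x)"
        using emeasure_bounded_finite[of "ball x0 s"]
        by (intro integrable_mult_right integrable_real_indicator) auto
      fix x
      have "\<delta>/2 \<le> \<eta> x" "x \<in> ?K" if "x \<in> ball x0 s"
        using d(2)[of x] that abs_ge_minus_self[of "\<eta> x - \<delta>"]
        by (auto simp: s_def dist_commute[of x] dist_real_def)
      then show "\<delta>/2 * indicator (ball x0 s) x \<le> indicator ?K x *\<^sub>R \<eta> x"
        using \<eta>pos[of x] by (auto simp: indicator_def)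
    qed (rule i\<eta>)
    finally show ?thesis by (simp add: set_lebesgue_integral_def)
  qed
  ultimately show False using c by (simp add: zero_le_mult_iff)
qed

section \<open>The flux of the energy\<close>

lemma norm_matrix_vector_mult_le:
  fixes A :: "real^'n^'m"
  shows "norm (A *v x) \<le> norm A * norm x"
proof -
  have "norm (A *v x) = L2_set (\<lambda>i. norm ((A *v x) $ i)) UNIV" by (simp add: norm_vec_def)
  also have "\<dots> \<le> L2_set (\<lambda>i. norm (A $ i) * norm x) UNIV"
    by (intro L2_set_mono) (auto simp: matrix_vector_mul_component Cauchy_Schwarz_ineq2)
  also have "\<dots> = norm A * norm x"
    by (simp add: L2_set_left_distrib[symmetric] norm_vec_def[of A])
  finally show ?thesis .
qed

text \<open>Brings the trace into the basis form in which the divergence appears in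
  \<open>integration_by_parts\<close>.\<close>

lemma trace_eq_sum_Basis:
  fixes X :: "real^'n^'n"
  shows "trace X = (\<Sum>b\<in>Basis. (X *v b) \<bullet> b)"
proof -
  have B: "(Basis :: (real^'n) set) = range (\<lambda>i. axis i 1)" by (auto simp: Basis_vec_def)
  have "(\<Sum>b\<in>Basis. (X *v b) \<bullet> b) = (\<Sum>i\<in>UNIV. (X *v axis i 1) \<bullet> axis i 1)"
    unfolding B by (rule sum.reindex_cong) (auto simp: inj_on_def axis_eq_axis)
  then show ?thesis by (simp add: trace_def inner_axis matrix_vector_mult_basis column_def)
qed

lemma inf_lap_eq_sum_Basis:
  fixes X :: "real^'n^'n"
  shows "inf_lap p X = (\<Sum>b\<in>Basis. (p \<bullet> (X *v b)) * (p \<bullet> b))"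
proof -
  have lin: "linear (\<lambda>v. p \<bullet> (X *v v))"
    by (rule linearI) (simp_all add: matrix_vector_right_distrib inner_add_right matrix_vector_mult_scaleR)
  have "inf_lap p X = p \<bullet> (X *v (\<Sum>b\<in>Basis. (p \<bullet> b) *\<^sub>R b))" by (simp add: inf_lap_def euclidean_representation)
  also have "\<dots> = (\<Sum>b\<in>Basis. (p \<bullet> b) * (p \<bullet> (X *v b)))"
    by (simp add: linear_sum[OF lin] linear_scale[OF lin] flip: real_scaleR_def)
  finally show ?thesis by (simp add: mult.commute)
qed

lemma inf_lap_uminus: "inf_lap (- p) (- X) = - inf_lap p X"
  by (simp add: inf_lap_eq_sum_Basis matrix_vector_mult_def inner_vec_def sum_negf)

text \<open>The divergence of the field with value h(|p|) p / |p| at p, in terms of the gradient p and the Hessian X.\<close>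

definition flux_div :: "(real \<Rightarrow> real) \<Rightarrow> (real \<Rightarrow> real) \<Rightarrow> real^'n \<Rightarrow> real^'n^'n \<Rightarrow> real" where
  "flux_div h h' p X = (h' (norm p) * norm p - h (norm p)) / norm p ^ 3 * inf_lap p X
    + h (norm p) / norm p * trace X"

text \<open>With h = f' the ratio h / (s h') is the coefficient a, so the bracket is the
  second-order part of the equation; for h' > 0 it has the same sign as the divergence.\<close>

lemma flux_div_eq:
  assumes "norm p > 0" "h' (norm p) \<noteq> 0"
  shows "flux_div h h' p X = h' (norm p) / (norm p)\<^sup>2 *
    ((1 - h (norm p) / (norm p * h' (norm p))) * inf_lap p X
      + (norm p)\<^sup>2 * (h (norm p) / (norm p * h' (norm p))) * trace X)"
proof -
  have "(A * s - B) / s ^ 3 * I + B / s * T = A / s\<^sup>2 * ((1 - B / (s * A)) * I + s\<^sup>2 * (B / (s * A)) * T)"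
    if "s \<noteq> 0" "A \<noteq> 0" for A B I T s :: real
    using that by (simp add: power2_eq_square power3_eq_cube divide_simps)
  from this[of "norm p" "h' (norm p)"] show ?thesis using assms by (simp add: flux_div_def)
qed

lemma flux_div_uminus: "flux_div h h' (- p) (- X) = - flux_div h h' p X"
  by (simp add: flux_div_def inf_lap_uminus trace_def sum_negf)

text \<open>On the ball the norm of the gradient stays in \<open>S\<close>, where \<open>h\<close>
  is C^1 and the argument positive, so the flux is a C^1 field with classical divergence
  \<open>flux_div\<close>. Integration by parts and \<eta> >= 0 turn the pointwise bound into the
  weak one.\<close>

lemma flux_weak_divergence:
  fixes D\<phi> :: "real^'n \<Rightarrow> real^'n" and D2\<phi> :: "real^'n \<Rightarrow> real^'n^'n"
  assumes r: "r > 0"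
    and D\<phi>: "\<And>x. x \<in> cball x0 r \<Longrightarrow> (D\<phi> has_derivative (\<lambda>v. D2\<phi> x *v v)) (at x)"
    and D2\<phi>: "continuous_on (cball x0 r) D2\<phi>"
    and S: "\<And>x. x \<in> cball x0 r \<Longrightarrow> norm (D\<phi> x) \<in> S" "S \<subseteq> {0<..}"
    and h: "\<And>s. s \<in> S \<Longrightarrow> (h has_real_derivative h' s) (at s)" "continuous_on S h'"
    and c: "\<And>x. x \<in> cball x0 r \<Longrightarrow> - c \<le> flux_div h h' (D\<phi> x) (D2\<phi> x)"
    and \<eta>: "L-lipschitz_on UNIV \<eta>" "\<And>x. 0 \<le> \<eta> x" "\<And>x. x \<notin> cball x0 (r/2) \<Longrightarrow> \<eta> x = 0"
  shows "(LINT x:cball x0 r|lebesgue. ((h (norm (D\<phi> x)) / norm (D\<phi> x)) *\<^sub>R D\<phi> x) \<bullet> grad \<eta> x)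
    \<le> c * (LINT x:cball x0 r|lebesgue. \<eta> x)"
proof -
  let ?K = "cball x0 r"
  define s where "s x = norm (D\<phi> x)" for x
  have spos: "s x > 0" if "x \<in> ?K" for x using subsetD[OF S(2) S(1)[OF that]] by (simp add: s_def)
  \<comment> \<open>The derivative of h(t)/t is (h'(t) t - h(t))/t^2; the third power comes from
    differentiating the norm, which contributes another 1/s.\<close>
  define \<alpha> where "\<alpha> x = (h' (s x) * s x - h (s x)) / s x ^ 3" for x
  define \<gamma> where "\<gamma> x = h (s x) / s x" for x
  define P where "P x = \<gamma> x *\<^sub>R D\<phi> x" for x
  define P' where "P' x v = (\<alpha> x * (D\<phi> x \<bullet> (D2\<phi> x *v v))) *\<^sub>R D\<phi> x + \<gamma> x *\<^sub>R (D2\<phi> x *v v)" for x v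
  have cD: "continuous_on ?K D\<phi>"
    using D\<phi> by (meson continuous_at_imp_continuous_on has_derivative_continuous)
  have cs: "continuous_on ?K s" unfolding s_def by (intro continuous_intros cD)
  have ch: "continuous_on S h"
    using h(1) by (meson DERIV_isCont continuous_at_imp_continuous_on)
  have chs: "continuous_on ?K (\<lambda>x. h (s x))" "continuous_on ?K (\<lambda>x. h' (s x))"
  proof -
    have sS: "s ` ?K \<subseteq> S" using S(1) by (simp add: s_def image_subset_iff)
    show "continuous_on ?K (\<lambda>x. h (s x))" "continuous_on ?K (\<lambda>x. h' (s x))"
      by (rule continuous_on_compose2[OF ch cs sS], rule continuous_on_compose2[OF h(2) cs sS])
  qed
  have c\<alpha>: "continuous_on ?K \<alpha>" and c\<gamma>: "continuous_on ?K \<gamma>"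
    unfolding \<alpha>_def \<gamma>_def using spos by (auto intro!: continuous_intros chs cs simp: less_imp_neq[symmetric])
  have dP: "(P has_derivative P' x) (at x)" if x: "x \<in> ?K" for x
  proof -
    have sx: "s x > 0" "D\<phi> x \<noteq> 0" using spos[OF x] by (auto simp: s_def)
    have ds: "(s has_derivative (\<lambda>v. (D\<phi> x \<bullet> (D2\<phi> x *v v)) / s x)) (at x)"
      unfolding s_def
      using has_derivative_compose[OF D\<phi>[OF x] has_derivative_norm[OF sx(2)]]
      by (simp add: sgn_div_norm inner_commute divide_inverse mult.commute)
    have "(h has_real_derivative h' (s x)) (at (s x))" using h(1) S(1)[OF x] by (simp add: s_def)
    from DERIV_divide[OF this DERIV_ident] sx
    have "((\<lambda>t. h t / t) has_real_derivative (h' (s x) * s x - h (s x)) / s x ^ 2) (at (s x))"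
      by (simp add: power2_eq_square)
    then have "((\<lambda>t. h t / t) has_derivative (\<lambda>y. (h' (s x) * s x - h (s x)) / s x ^ 2 * y)) (at (s x))"
      by (simp only: has_field_derivative_def)
    from has_derivative_compose[OF ds this]
    have d\<gamma>: "(\<gamma> has_derivative (\<lambda>v. \<alpha> x * (D\<phi> x \<bullet> (D2\<phi> x *v v)))) (at x)"
      using sx(1) unfolding \<gamma>_def \<alpha>_def by (simp add: power2_eq_square power3_eq_cube mult.commute mult.left_commute)
    show ?thesis
      unfolding P_def P'_def using has_derivative_scaleR[OF d\<gamma> D\<phi>[OF x]] by (simp add: add.commute)
  qed
  have "\<exists>B. B-lipschitz_on ?K P"
  proof -
    \<comment> \<open>A pointwise bound for the operator norm of \<open>P' x\<close>; any upper
      bound of it on the convex ball is a Lipschitz constant of \<open>P\<close>.\<close>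
    define M where "M x = (\<bar>\<alpha> x\<bar> * s x * s x + \<bar>\<gamma> x\<bar>) * norm (D2\<phi> x)" for x
    have "continuous_on ?K M" unfolding M_def by (intro continuous_intros c\<alpha> c\<gamma> cs D2\<phi>)
    then have "bounded (M ` ?K)" by (intro compact_imp_bounded compact_continuous_image) auto
    then obtain B where B: "\<And>x. x \<in> ?K \<Longrightarrow> \<bar>M x\<bar> \<le> B"
      unfolding bounded_iff by (metis imageI real_norm_def)
    have "\<bar>B\<bar>-lipschitz_on ?K P"
    proof (rule lipschitz_onI)
      fix x y assume xy: "x \<in> ?K" "y \<in> ?K"
      have "norm (P x - P y) \<le> \<bar>B\<bar> * norm (x - y)"
      proof (rule differentiable_bound[where S = ?K, OF convex_cball _ _ xy])
        fix z assume z: "z \<in> ?K"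
        show "(P has_derivative P' z) (at z within ?K)"
          using dP[OF z] by (rule has_derivative_at_withinI)
        show "onorm (P' z) \<le> \<bar>B\<bar>"
        proof (rule onorm_le)
          fix v
          let ?w = "D2\<phi> z *v v"
          have "norm (P' z v) \<le> \<bar>\<alpha> z\<bar> * \<bar>D\<phi> z \<bullet> ?w\<bar> * s z + \<bar>\<gamma> z\<bar> * norm ?w"
            unfolding P'_def s_def by (rule order_trans[OF norm_triangle_ineq]) (simp add: abs_mult)
          also have "\<dots> \<le> \<bar>\<alpha> z\<bar> * (s z * norm ?w) * s z + \<bar>\<gamma> z\<bar> * norm ?w"
            using Cauchy_Schwarz_ineq2[of "D\<phi> z" ?w] spos[OF z]
            by (intro add_right_mono mult_right_mono mult_left_mono) (auto simp: s_def)
          also have "\<dots> = (\<bar>\<alpha> z\<bar> * s z * s z + \<bar>\<gamma> z\<bar>) * norm ?w" by (simp add: algebra_simps)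
          also have "\<dots> \<le> (\<bar>\<alpha> z\<bar> * s z * s z + \<bar>\<gamma> z\<bar>) * (norm (D2\<phi> z) * norm v)"
            using spos[OF z] by (intro mult_left_mono norm_matrix_vector_mult_le) auto
          also have "\<dots> = M z * norm v" by (simp add: M_def)
          also have "\<dots> \<le> \<bar>B\<bar> * norm v" using B[OF z] by (intro mult_right_mono) auto
          finally show "norm (P' z v) \<le> \<bar>B\<bar> * norm v" .
        qed
      qed
      then show "dist (P x) (P y) \<le> \<bar>B\<bar> * dist x y" by (simp add: dist_norm)
    qed simp
    then show ?thesis ..
  qed
  then obtain B where B: "B-lipschitz_on ?K P" ..
  define D where "D x = flux_div h h' (D\<phi> x) (D2\<phi> x)" for x
  have Deq: "D x = \<alpha> x * (D\<phi> x \<bullet> (D2\<phi> x *v D\<phi> x)) + \<gamma> x * trace (D2\<phi> x)" for x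
    by (simp add: D_def flux_div_def \<alpha>_def \<gamma>_def s_def inf_lap_def)
  have Dsum: "D x = (\<Sum>b\<in>Basis. P' x b \<bullet> b)" for x
    unfolding P'_def inner_add_left sum.distrib inner_scaleR_left sum_distrib_left[symmetric]
      trace_eq_sum_Basis[symmetric] mult.assoc inf_lap_eq_sum_Basis[symmetric]
    by (simp add: Deq inf_lap_def)
  have cD': "continuous_on ?K D"
    unfolding D_def flux_div_def inf_lap_def trace_def s_def[symmetric] matrix_vector_mult_def
      \<alpha>_def[symmetric] \<gamma>_def[symmetric]
    by (intro continuous_intros c\<alpha> c\<gamma> cD D2\<phi>)
  have c\<eta>: "continuous_on ?K \<eta>"
    using lipschitz_on_continuous_on[OF \<eta>(1)] by (rule continuous_on_subset) auto
  have "(LINT x:?K|lebesgue. P x \<bullet> grad \<eta> x) = - (LINT x:?K|lebesgue. \<eta> x * D x)"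
    using integration_by_parts[where \<rho> = "r/2", OF \<eta>(1) \<eta>(3) _ dP B Dsum cD'] r by simp
  also have "\<dots> = (LINT x:?K|lebesgue. - (\<eta> x * D x))"
    by (simp add: set_lebesgue_integral_def)
  also have "\<dots> \<le> (LINT x:?K|lebesgue. c * \<eta> x)"
  proof (rule set_integral_mono)
    show "set_integrable lebesgue ?K (\<lambda>x. - (\<eta> x * D x))" "set_integrable lebesgue ?K (\<lambda>x. c * \<eta> x)"
      by (intro set_integrable_continuous_compact continuous_intros compact_cball c\<eta> cD')+
    show "- (\<eta> x * D x) \<le> c * \<eta> x" if "x \<in> ?K" for x
      using mult_left_mono[OF c[OF that] \<eta>(2)[of x]] by (simp add: D_def algebra_simps)
  qed
  also have "\<dots> = c * (LINT x:?K|lebesgue. \<eta> x)" by simp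
  finally show ?thesis unfolding P_def \<gamma>_def s_def .
qed

section \<open>Contact with a minimizer\<close>

locale energy =
  fixes \<Omega> :: "(real^'n) set" and f f1 :: "real \<Rightarrow> real" and \<sigma> :: real
  assumes domain: "open \<Omega>" "bounded \<Omega>"
    and sigma: "0 < \<sigma>"
    and f_convex: "convex_on {0..} f"
    and f_mono: "mono_on {0..} f"
    and f_deriv: "\<And>s. 0 \<le> s \<Longrightarrow> (f has_real_derivative f1 s) (at s within {0..})"
    and f1_cont: "continuous_on {0..} f1"
    and f_0: "f 0 = 0"
    and f1_zero: "\<And>s. 0 \<le> s \<Longrightarrow> s \<le> \<sigma> \<Longrightarrow> f1 s = 0"
begin

lemma f_cont: "continuous_on {0..} f"
  using f_deriv by (intro DERIV_continuous_on) auto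

lemma f_tangent: "f s + f1 s * (t - s) \<le> f t" if "0 < s" "0 \<le> t"
  using convex_on_imp_above_tangent[OF f_convex, of s t "f1 s"] f_deriv[of s] that
  by (auto simp: connected_Ici interior_real_atLeast)

lemma f_nonneg: "0 \<le> f s" if "0 \<le> s"
  using mono_onD[OF f_mono, of 0 s] that f_0 by simp

text \<open>For s > 0 the tangent at \<open>s\<close> is horizontal, and comparing it with
  \<open>f\<close> at 0 gives f(s) <= f(0) = 0.\<close>

lemma f_flat: "f s = 0" if "0 \<le> s" "s \<le> \<sigma>"
  using f_tangent[of s 0] f_nonneg[of s] f1_zero[of s] f_0 that by (cases "s = 0") auto

lemma f1_nonneg: "0 \<le> f1 s" if "0 < s"
proof -
  have "0 \<le> f1 s * s" using f_tangent[of s 0] f_nonneg[of s] f_0 that by simp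
  then show ?thesis using that by (simp add: zero_le_mult_iff)
qed

text \<open>Since f' >= 0, Cauchy-Schwarz may replace the inner product of p and q by |p| |q|, which
  leaves the tangent inequality of \<open>f\<close> on the half-line.\<close>

lemma flux_subgradient:
  assumes "p \<noteq> 0"
  shows "f (norm p) + ((f1 (norm p) / norm p) *\<^sub>R p) \<bullet> (q - p) \<le> f (norm q)"
proof -
  let ?s = "norm p"
  have s: "?s > 0" using assms by simp
  have "((f1 ?s / ?s) *\<^sub>R p) \<bullet> (q - p) = f1 ?s / ?s * (p \<bullet> q - ?s * ?s)"
    by (simp add: inner_diff_right dot_square_norm power2_eq_square right_diff_distrib)
  also have "\<dots> \<le> f1 ?s / ?s * (?s * norm q - ?s * ?s)"
    using f1_nonneg[OF s] s norm_cauchy_schwarz[of p q] by (intro mult_left_mono) auto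
  also have "\<dots> = f1 ?s * (norm q - ?s)" using s by (simp add: field_simps)
  finally show ?thesis using f_tangent[OF s, of "norm q"] by simp
qed

end

text \<open>Contact is always from below: \<kappa> = 1 serves \<open>u\<close> itself and \<kappa> =
  -1 serves -u, whose energy carries the linear term with the opposite sign.\<close>

locale contact = energy \<Omega> f f1 \<sigma>
  for \<Omega> :: "(real^'n) set" and f f1 :: "real \<Rightarrow> real" and \<sigma> :: real +
  fixes \<kappa> :: real and u \<phi> :: "real^'n \<Rightarrow> real" and D\<phi> :: "real^'n \<Rightarrow> real^'n"
    and D2\<phi> :: "real^'n \<Rightarrow> real^'n^'n" and x0 :: "real^'n"
  assumes u_W: "u \<in> W1inf0 \<Omega>"
    and u_min: "\<And>v. v \<in> W1inf0 \<Omega> \<Longrightarrow>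
      (LINT x:\<Omega>|lebesgue. f (norm (grad u x)) - \<kappa> * u x) \<le> (LINT x:\<Omega>|lebesgue. f (norm (grad v x)) - \<kappa> * v x)"
    and \<phi>_C2: "C2_on \<Omega> \<phi> D\<phi> D2\<phi>"
    and x0: "x0 \<in> \<Omega>" "u x0 = \<phi> x0"
    and below: "\<And>x. x \<in> \<Omega> \<Longrightarrow> x \<noteq> x0 \<Longrightarrow> \<phi> x < u x"
begin

lemma \<phi>_deriv: "x \<in> \<Omega> \<Longrightarrow> (\<phi> has_derivative (\<lambda>h. D\<phi> x \<bullet> h)) (at x)"
  and D\<phi>_deriv: "x \<in> \<Omega> \<Longrightarrow> (D\<phi> has_derivative (\<lambda>h. D2\<phi> x *v h)) (at x)"
  and D2\<phi>_cont: "continuous_on \<Omega> D2\<phi>"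
  using \<phi>_C2 by (auto simp: C2_on_def)

lemma D\<phi>_cont: "continuous_on \<Omega> D\<phi>"
  using D\<phi>_deriv by (meson continuous_at_imp_continuous_on has_derivative_continuous)

lemma eventually_imp_cball:
  assumes "eventually Q (nhds x0)"
  shows "\<exists>r>0. cball x0 r \<subseteq> \<Omega> \<and> (\<forall>x\<in>cball x0 r. Q x)"
proof -
  have "eventually (\<lambda>x. x \<in> \<Omega> \<and> Q x) (nhds x0)"
    using assms eventually_nhds_in_open[OF domain(1) x0(1)] by eventually_elim auto
  then obtain d where d: "d > 0" "\<And>x. dist x x0 < d \<Longrightarrow> x \<in> \<Omega> \<and> Q x"
    by (auto simp: eventually_nhds_metric)
  show ?thesis
    using d by (intro exI[of _ "d/2"]) (auto simp: dist_commute)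
qed

lemma tendsto_nhds_x0:
  assumes "continuous_on V g" "open V" "x0 \<in> V"
  shows "(g \<longlongrightarrow> g x0) (nhds x0)"
  using assms by (metis continuous_on_eq_continuous_at isCont_def tendsto_at_iff_tendsto_nhds)

text \<open>Near \<open>x0\<close> the zero vector is a subgradient, because \<open>f\<close> is
  nonnegative and vanishes up to \<sigma>. With zero flux, raising \<open>u\<close> lowers the
  energy through the linear term alone.\<close>

lemma no_contact_flat:
  assumes "norm (D\<phi> x0) < \<sigma>" "0 < \<kappa>"
  shows False
proof -
  have "eventually (\<lambda>x. norm (D\<phi> x) < \<sigma>) (nhds x0)"
    using order_tendstoD(2)[OF tendsto_norm[OF tendsto_nhds_x0[OF D\<phi>_cont domain(1) x0(1)]] assms(1)] .
  from eventually_imp_cball[OF this] obtain r where r: "r > 0" "cball x0 r \<subseteq> \<Omega>"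
    "\<And>x. x \<in> cball x0 r \<Longrightarrow> norm (D\<phi> x) < \<sigma>" by blast
  show False
  proof (rule no_contact_from_below[OF domain f_cont u_W u_min \<phi>_deriv D\<phi>_cont x0(2) below r(1,2), where P = "\<lambda>_. 0" and c = 0])
    fix x q assume "x \<in> cball x0 r"
    then have "f (norm (D\<phi> x)) = 0" using r(3) by (intro f_flat) (auto simp: less_imp_le)
    then show "f (norm (D\<phi> x)) + 0 \<bullet> (q - D\<phi> x) \<le> f (norm q)" using f_nonneg[of "norm q"] by simp
  qed (use assms(2) in auto)
qed

text \<open>The flux f' is approximated by smoother fluxes H n, since f' need not be differentiable
  where the gradient of the test function has norm \<open>\<sigma>\<close>.\<close>

lemma no_contact_flux:
  assumes r: "r > 0" "cball x0 r \<subseteq> \<Omega>"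
    and S: "\<And>x. x \<in> cball x0 r \<Longrightarrow> norm (D\<phi> x) \<in> S" "S \<subseteq> {0<..}"
    and H: "\<And>n s. s \<in> S \<Longrightarrow> (H n has_real_derivative H' n s) (at s)" "\<And>n. continuous_on S (H' n)"
    and unif: "uniform_limit S H f1 sequentially"
    and div: "\<forall>\<^sub>F n in sequentially. \<forall>x\<in>cball x0 r. - c \<le> flux_div (H n) (H' n) (D\<phi> x) (D2\<phi> x)"
    and c: "c < \<kappa>"
  shows False
proof -
  let ?K = "cball x0 r"
  define F where "F h x = (h (norm (D\<phi> x)) / norm (D\<phi> x)) *\<^sub>R D\<phi> x" for h x
  have D\<phi>K: "continuous_on ?K D\<phi>" using D\<phi>_cont r(2) by (rule continuous_on_subset)
  have spos: "norm (D\<phi> x) > 0" if "x \<in> ?K" for x using subsetD[OF S(2) S(1)[OF that]] by simp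
  have cF: "continuous_on ?K (F h)" if "continuous_on S h" for h
  proof -
    have "continuous_on ?K (\<lambda>x. h (norm (D\<phi> x)))"
      using S(1) by (intro continuous_on_compose2[OF that] continuous_intros D\<phi>K) auto
    then show ?thesis unfolding F_def
      using spos by (intro continuous_intros D\<phi>K) auto
  qed
  have cf1: "continuous_on S f1" using f1_cont S(2) by (rule continuous_on_subset[OF _ order_trans]) auto
  have cH: "continuous_on S (H n)" for n
    using H(1) by (meson DERIV_isCont continuous_at_imp_continuous_on)
  show False
  \<comment> \<open>The subgradient inequality is required for the exact flux of \<open>f1\<close>;
    the approximations \<open>H n\<close> enter only in the weak inequality, up to an arbitrary
    error \<open>e\<close>.\<close>
  proof (rule no_contact_from_below[OF domain f_cont u_W u_min \<phi>_deriv D\<phi>_cont x0(2) below r cF[OF cf1] _ _ c])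
    show "f (norm (D\<phi> x)) + F f1 x \<bullet> (q - D\<phi> x) \<le> f (norm q)" if "x \<in> ?K" for x q
      using flux_subgradient[of "D\<phi> x" q] spos[OF that] by (auto simp: F_def)
    fix \<eta> :: "real^'n \<Rightarrow> real" and L
    assume \<eta>: "L-lipschitz_on UNIV \<eta>" "\<And>x. 0 \<le> \<eta> x" "\<And>x. x \<notin> cball x0 (r/2) \<Longrightarrow> \<eta> x = 0"
    have L0: "L \<ge> 0" using \<eta>(1) by (rule lipschitz_on_nonneg)
    show "(LINT x:?K|lebesgue. F f1 x \<bullet> grad \<eta> x) \<le> c * (LINT x:?K|lebesgue. \<eta> x)"
    proof (rule field_le_epsilon)
      fix e :: real assume e: "e > 0"
      define m where "m = measure lebesgue ?K"
      have m0: "m \<ge> 0" by (simp add: m_def)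
      \<comment> \<open>Fluxes closer than \<open>e'\<close> change the integral by at most
        \<open>e' * (L * m)\<close>, since the gradient of \<eta> is bounded by \<open>L\<close>;
        the summand 1 avoids division by zero.\<close>
      define e' where "e' = e / (L * m + 1)"
      have Lm: "0 \<le> L * m" using L0 m0 by simp
      then have e': "e' > 0" using e by (simp add: e'_def)
      have "e' * (L * m) \<le> e' * (L * m + 1)" using e' by simp
      also have "\<dots> = e" using Lm by (simp add: e'_def)
      finally have e'e: "e' * (L * m) \<le> e" .
      have "\<forall>\<^sub>F n in sequentially. (\<forall>s\<in>S. dist (H n s) (f1 s) < e') \<and> (\<forall>x\<in>?K. - c \<le> flux_div (H n) (H' n) (D\<phi> x) (D2\<phi> x))"
        using uniform_limitD[OF unif e'] div by (rule eventually_conj)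
      from eventually_happens'[OF sequentially_bot this]
      obtain n where n: "\<And>s. s \<in> S \<Longrightarrow> dist (H n s) (f1 s) < e'"
        "\<And>x. x \<in> ?K \<Longrightarrow> - c \<le> flux_div (H n) (H' n) (D\<phi> x) (D2\<phi> x)"
        by blast
      have w: "(LINT x:?K|lebesgue. F (H n) x \<bullet> grad \<eta> x) \<le> c * (LINT x:?K|lebesgue. \<eta> x)"
        unfolding F_def
        by (rule flux_weak_divergence[OF r(1) _ _ S H(1) H(2) n(2) \<eta>])
           (use r(2) D\<phi>_deriv continuous_on_subset[OF D2\<phi>_cont r(2)] in auto)
      have i1: "integrable lebesgue (\<lambda>x. indicator ?K x *\<^sub>R (F h x \<bullet> grad \<eta> x))" if "continuous_on S h" for h
        using set_integrable_inner_grad[OF \<eta>(1) compact_cball cF[OF that]] by (simp add: set_integrable_def)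
      have i2: "integrable lebesgue (\<lambda>x. indicator ?K x *\<^sub>R (e' * L))"
        unfolding set_integrable_def[symmetric]
        by (intro set_integrable_continuous_compact compact_cball continuous_on_const)
      have "(LINT x:?K|lebesgue. F f1 x \<bullet> grad \<eta> x)
          \<le> (LINT x|lebesgue. indicator ?K x *\<^sub>R (F (H n) x \<bullet> grad \<eta> x) + indicator ?K x *\<^sub>R (e' * L))"
        unfolding set_lebesgue_integral_def
      proof (rule integral_mono_AE)
        show "AE x in lebesgue. indicator ?K x *\<^sub>R (F f1 x \<bullet> grad \<eta> x)
            \<le> indicator ?K x *\<^sub>R (F (H n) x \<bullet> grad \<eta> x) + indicator ?K x *\<^sub>R (e' * L)"
        proof (rule eventually_mono[OF AE_norm_grad_le[OF \<eta>(1)]])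
          fix x assume g: "norm (grad \<eta> x) \<le> L"
          have "F f1 x \<bullet> grad \<eta> x \<le> F (H n) x \<bullet> grad \<eta> x + e' * L" if x: "x \<in> ?K"
          proof -
            let ?s = "norm (D\<phi> x)"
            \<comment> \<open>Both fluxes are multiples of the same unit vector, so their distance
              is that of the scalars \<open>f1 ?s\<close> and \<open>H n ?s\<close>.\<close>
            have "F f1 x - F (H n) x = ((f1 ?s - H n ?s) / ?s) *\<^sub>R D\<phi> x"
              by (simp add: F_def diff_divide_distrib scaleR_diff_left)
            then have "norm (F f1 x - F (H n) x) = \<bar>f1 ?s - H n ?s\<bar>"
              using spos[OF x] by (simp add: abs_divide)
            also have "\<dots> \<le> e'" using n(1)[OF S(1)[OF x]] by (simp add: dist_real_def abs_minus_commute)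
            finally have "norm (F f1 x - F (H n) x) * norm (grad \<eta> x) \<le> e' * L"
              using g e' by (intro mult_mono) auto
            then show ?thesis
              using norm_cauchy_schwarz[of "F f1 x - F (H n) x" "grad \<eta> x"] by (simp add: inner_diff_left)
          qed
          then show "indicator ?K x *\<^sub>R (F f1 x \<bullet> grad \<eta> x)
            \<le> indicator ?K x *\<^sub>R (F (H n) x \<bullet> grad \<eta> x) + indicator ?K x *\<^sub>R (e' * L)"
            by (simp add: indicator_def)
        qed
      qed (intro Bochner_Integration.integrable_add i1 i2 cf1 cH)+
      also have "\<dots> = (LINT x:?K|lebesgue. F (H n) x \<bullet> grad \<eta> x) + e' * L * m"
        unfolding set_lebesgue_integral_def
        by (subst Bochner_Integration.integral_add[OF i1[OF cH] i2]) (simp add: m_def)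
      also have "\<dots> \<le> c * (LINT x:?K|lebesgue. \<eta> x) + e" using w e'e by (simp add: mult.assoc)
      finally show "(LINT x:?K|lebesgue. F f1 x \<bullet> grad \<eta> x) \<le> c * (LINT x:?K|lebesgue. \<eta> x) + e" .
    qed
  qed
qed

text \<open>Beyond \<sigma> the flux of \<open>f\<close> is itself C^1, so the constant sequence
  serves as approximation; the strict inequality at \<open>x0\<close> leaves room for some c <
  \<kappa> and extends to a ball by continuity.\<close>

lemma no_contact_regular:
  assumes f2: "\<And>s. \<sigma> < s \<Longrightarrow> (f1 has_real_derivative f2 s) (at s)" "continuous_on {\<sigma><..} f2"
    and p: "\<sigma> < norm (D\<phi> x0)" and div: "- \<kappa> < flux_div f1 f2 (D\<phi> x0) (D2\<phi> x0)"
  shows False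
proof -
  define V where "V = {x \<in> \<Omega>. \<sigma> < norm (D\<phi> x)}"
  define g where "g x = flux_div f1 f2 (D\<phi> x) (D2\<phi> x)" for x
  have "continuous_on \<Omega> (\<lambda>x. norm (D\<phi> x))" by (intro continuous_intros D\<phi>_cont)
  from continuous_open_preimage[OF this domain(1), of "{\<sigma><..}"]
  have V: "open V" "x0 \<in> V" using x0 p by (auto simp: V_def vimage_def Int_def)
  have cV: "continuous_on V D\<phi>" "continuous_on V D2\<phi>"
    using continuous_on_subset[OF D\<phi>_cont] continuous_on_subset[OF D2\<phi>_cont] by (auto simp: V_def)
  have cs: "continuous_on V (\<lambda>x. f1 (norm (D\<phi> x)))" "continuous_on V (\<lambda>x. f2 (norm (D\<phi> x)))"
  proof -
    have n: "continuous_on V (\<lambda>x. norm (D\<phi> x))" by (intro continuous_intros cV)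
    show "continuous_on V (\<lambda>x. f1 (norm (D\<phi> x)))" "continuous_on V (\<lambda>x. f2 (norm (D\<phi> x)))"
      by (rule continuous_on_compose2[OF f1_cont n], simp add: image_subset_iff)
         (rule continuous_on_compose2[OF f2(2) n], simp add: image_subset_iff V_def)
  qed
  have "continuous_on V g"
    unfolding g_def flux_div_def inf_lap_def trace_def matrix_vector_mult_def
    using sigma by (intro continuous_intros cV cs) (auto simp: V_def)
  then have g: "(g \<longlongrightarrow> g x0) (nhds x0)" using V by (rule tendsto_nhds_x0)
  obtain c where c: "- g x0 < c" "c < \<kappa>" using div dense[of "- g x0" \<kappa>] by (auto simp: g_def)
  have "eventually (\<lambda>x. x \<in> V \<and> - c < g x) (nhds x0)"
    using eventually_nhds_in_open[OF V] order_tendstoD(1)[OF g, of "- c"] c by (intro eventually_conj) auto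
  from eventually_imp_cball[OF this] obtain r where r: "r > 0" "cball x0 r \<subseteq> \<Omega>"
    "\<And>x. x \<in> cball x0 r \<Longrightarrow> x \<in> V \<and> - c < g x" by blast
  show False
  proof (rule no_contact_flux[where S = "{\<sigma><..}" and H = "\<lambda>_. f1" and H' = "\<lambda>_. f2", OF r(1,2) _ _ _ f2(2) _ _ c(2)])
    show "\<forall>\<^sub>F n in sequentially. \<forall>x\<in>cball x0 r. - c \<le> flux_div f1 f2 (D\<phi> x) (D2\<phi> x)"
      using r(3) by (auto simp: g_def intro!: always_eventually less_imp_le)
  qed (use r(3) f2(1) sigma in \<open>auto simp: V_def intro!: uniform_limit_const\<close>)
qed

text \<open>The factor H'/s^2 in \<open>flux_div_eq\<close> is positive, but its size as n grows is
  not controlled, so only the sign of the divergence is obtained; it suffices because 0 < \<kappa>.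
  It is the sign of (1 - A) I + A T, where A = H / (s H') is small for gradients of norm near
  \<sigma> and I stays away from 0.\<close>

lemma no_contact_degenerate:
  assumes p: "norm (D\<phi> x0) = \<sigma>" "0 < inf_lap (D\<phi> x0) (D2\<phi> x0)" and \<kappa>: "0 < \<kappa>"
    and H: "\<And>n s. 0 < s \<Longrightarrow> (H n has_real_derivative H' n s) (at s)" "\<And>n. continuous_on {0<..} (H' n)"
      "\<And>n s. 0 < s \<Longrightarrow> 0 < H' n s"
    and H_unif: "\<And>K. compact K \<Longrightarrow> K \<subseteq> {0..} \<Longrightarrow> uniform_limit K H f1 sequentially"
    and a_unif: "\<And>K. compact K \<Longrightarrow> K \<subseteq> {0<..} \<Longrightarrow> uniform_limit K (\<lambda>n s. H n s / (s * H' n s)) a sequentially"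
    and a: "(a \<longlongrightarrow> 0) (nhds \<sigma>)"
  shows False
proof -
  define I where "I x = inf_lap (D\<phi> x) (D2\<phi> x)" for x
  define T where "T x = (norm (D\<phi> x))\<^sup>2 * trace (D2\<phi> x)" for x
  have cI: "continuous_on \<Omega> I" and cT: "continuous_on \<Omega> T"
    unfolding I_def T_def inf_lap_def trace_def matrix_vector_mult_def
    by (intro continuous_intros D\<phi>_cont D2\<phi>_cont)+
  note lim = tendsto_nhds_x0[OF _ domain(1) x0(1)]
  \<comment> \<open>Near \<open>x0\<close>, I > m and |I| + |T| < M. With e = m / (2 M) the ratio A
    is at most 2 e in modulus, one e from uniform convergence and one from the smallness of
    \<open>a\<close> near \<sigma>; hence |A| (|I| + |T|) <= m < I.\<close>
  define m where "m = I x0 / 2"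
  have m: "0 < m" "m < I x0" using p(2) by (auto simp: m_def I_def)
  define M where "M = \<bar>I x0\<bar> + \<bar>T x0\<bar> + 1"
  have M: "M > 0" by (simp add: M_def)
  define e where "e = m / (2 * M)"
  have e: "e > 0" using m M by (simp add: e_def)
  have "\<forall>\<^sub>F s in nhds \<sigma>. \<bar>a s\<bar> < e"
    using order_tendstoD(2)[OF tendsto_rabs[OF a], of e] e by simp
  then obtain d where d: "d > 0" "\<And>s. dist s \<sigma> < d \<Longrightarrow> \<bar>a s\<bar> < e"
    by (auto simp: eventually_nhds_metric)
  \<comment> \<open>Below \<open>d\<close> for the smallness of \<open>a\<close>, and below \<sigma>
    to keep \<open>S\<close> inside the open half-line, on whose compact subsets the ratios
    converge.\<close>
  define \<tau> where "\<tau> = min (d/2) (\<sigma>/2)"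
  have \<tau>: "\<tau> > 0" "\<tau> < d" "\<tau> < \<sigma>" using d(1) sigma by (auto simp: \<tau>_def)
  define S where "S = {\<sigma> - \<tau>..\<sigma> + \<tau>}"
  have S: "compact S" "S \<subseteq> {0<..}" using \<tau> by (auto simp: S_def)
  have aS: "\<bar>a s\<bar> < e" if "s \<in> S" for s using that \<tau> by (intro d(2)) (auto simp: S_def dist_real_def)
  have "eventually (\<lambda>x. (norm (D\<phi> x) > \<sigma> - \<tau> \<and> norm (D\<phi> x) < \<sigma> + \<tau>) \<and> m < I x \<and> \<bar>I x\<bar> + \<bar>T x\<bar> < M) (nhds x0)"
    using order_tendstoD[OF tendsto_norm[OF lim[OF D\<phi>_cont]]] p(1) \<tau>(1)
      order_tendstoD(1)[OF lim[OF cI] m(2)]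
      order_tendstoD(2)[OF tendsto_add[OF tendsto_rabs[OF lim[OF cI]] tendsto_rabs[OF lim[OF cT]]], of M]
    by (intro eventually_conj) (auto simp: M_def)
  from eventually_imp_cball[OF this] obtain r where r: "r > 0" "cball x0 r \<subseteq> \<Omega>"
    and near: "\<And>x. x \<in> cball x0 r \<Longrightarrow> norm (D\<phi> x) \<in> S" "\<And>x. x \<in> cball x0 r \<Longrightarrow> m < I x"
      "\<And>x. x \<in> cball x0 r \<Longrightarrow> \<bar>I x\<bar> + \<bar>T x\<bar> < M"
    by (force simp: S_def)
  show False
  proof (rule no_contact_flux[OF r near(1) S(2) _ _ _ _ \<kappa>])
    show "\<forall>\<^sub>F n in sequentially. \<forall>x\<in>cball x0 r. - 0 \<le> flux_div (H n) (H' n) (D\<phi> x) (D2\<phi> x)"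
      using uniform_limitD[OF a_unif[OF S] e]
    proof (eventually_elim, intro ballI)
      fix n x assume n: "\<forall>s\<in>S. dist (H n s / (s * H' n s)) (a s) < e" and x: "x \<in> cball x0 r"
      let ?s = "norm (D\<phi> x)"
      define A where "A = H n ?s / (?s * H' n ?s)"
      have s: "?s > 0" "?s \<in> S" using near(1)[OF x] S(2) by auto
      have "\<bar>A\<bar> \<le> 2 * e" using n s(2) aS[OF s(2)] by (force simp: A_def dist_real_def)
      then have "\<bar>A\<bar> * (\<bar>I x\<bar> + \<bar>T x\<bar>) \<le> 2 * e * M" using near(3)[OF x] M e by (intro mult_mono) auto
      also have "\<dots> = m" using M by (simp add: e_def)
      finally have "\<bar>A * I x\<bar> + \<bar>A * T x\<bar> \<le> m" by (simp add: abs_mult distrib_left)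
      then have "0 \<le> (1 - A) * I x + A * T x" using near(2)[OF x] by (simp add: left_diff_distrib)
      moreover have "flux_div (H n) (H' n) (D\<phi> x) (D2\<phi> x) = H' n ?s / ?s\<^sup>2 * ((1 - A) * I x + A * T x)"
        using H(3)[OF s(1), of n] s(1) by (subst flux_div_eq) (auto simp: A_def I_def T_def mult_ac)
      ultimately show "- 0 \<le> flux_div (H n) (H' n) (D\<phi> x) (D2\<phi> x)"
        using H(3)[OF s(1), of n] by simp
    qed
    show "uniform_limit S H f1 sequentially" using S by (intro H_unif) auto
    show "continuous_on S (H' n)" for n using H(2) S(2) by (rule continuous_on_subset)
  qed (use H(1) S(2) in auto)
qed

end

section \<open>Reflection, and the coefficient a at \<sigma>\<close>

text \<open>Norms are compared because, where \<open>v\<close> is not differentiable, both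
  \<open>grad\<close> terms choose from the same empty predicate and are therefore equal, not
  opposite.\<close>

lemma norm_grad_uminus: "norm (grad (\<lambda>x. - v x) x) = norm (grad v x)"
proof (cases "v differentiable (at x)")
  case True
  have "((\<lambda>x. - v x) has_derivative (\<lambda>h. (- grad v x) \<bullet> h)) (at x)"
    using has_derivative_minus[OF has_derivative_grad[OF True]] by simp
  from grad_eqI[OF this] show ?thesis by simp
next
  case False
  have "\<not> (\<lambda>x. - v x) differentiable (at x)"
    using False differentiable_minus[of "\<lambda>x. - v x"] by auto
  then show ?thesis using False by (simp add: grad_def differentiable_def)
qed

lemma W1inf0_uminus: "v \<in> W1inf0 \<Omega> \<Longrightarrow> (\<lambda>x. - v x) \<in> W1inf0 \<Omega>"
  by (auto simp: W1inf0_def)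

lemma C2_on_uminus:
  assumes "C2_on U \<phi> D\<phi> D2\<phi>"
  shows "C2_on U (\<lambda>x. - \<phi> x) (\<lambda>x. - D\<phi> x) (\<lambda>x. - D2\<phi> x)"
proof -
  have neg: "(- A) *v h = - (A *v h)" for A :: "real^'n^'n" and h
    by (simp add: matrix_vector_mult_def vec_eq_iff sum_negf)
  show ?thesis
    using assms by (auto simp: C2_on_def neg intro!: has_derivative_minus continuous_on_minus)
qed

text \<open>Just to the right of \<sigma>, f'' >= 1 bounds the denominator below by \<sigma>, while
  f' tends to f'(\<sigma>) = 0; on the left the value is 0 by definition.\<close>

lemma afun_tendsto_0:
  assumes "0 < \<sigma>" "continuous_on {0..} f1" "f1 \<sigma> = 0" "filterlim f2 at_top (at_right \<sigma>)"
  shows "(afun \<sigma> f1 f2 \<longlongrightarrow> 0) (nhds \<sigma>)"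
proof (rule tendstoI)
  fix e :: real assume e: "e > 0"
  have "isCont f1 \<sigma>" using assms(1,2) by (intro continuous_on_interior) (auto simp: interior_real_atLeast)
  then have "(f1 \<longlongrightarrow> 0) (nhds \<sigma>)" using assms(3) by (metis isCont_def tendsto_at_iff_tendsto_nhds)
  then have "\<forall>\<^sub>F s in nhds \<sigma>. dist (f1 s) 0 < e * \<sigma>" using e assms(1) by (intro tendstoD) auto
  then obtain d where d: "d > 0" "\<And>s. dist s \<sigma> < d \<Longrightarrow> \<bar>f1 s\<bar> < e * \<sigma>"
    by (auto simp: eventually_nhds_metric)
  have "\<forall>\<^sub>F s in at_right \<sigma>. 1 \<le> f2 s" using assms(4) by (auto simp: filterlim_at_top)
  then obtain b where b: "b > \<sigma>" "\<And>s. \<sigma> < s \<Longrightarrow> s < b \<Longrightarrow> 1 \<le> f2 s"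
    by (auto simp: eventually_at_right_field)
  show "\<forall>\<^sub>F s in nhds \<sigma>. dist (afun \<sigma> f1 f2 s) 0 < e"
    unfolding eventually_nhds_metric
  proof (intro exI[of _ "min d (b - \<sigma>)"] conjI allI impI)
    show "0 < min d (b - \<sigma>)" using d(1) b(1) by simp
    fix s assume s: "dist s \<sigma> < min d (b - \<sigma>)"
    show "dist (afun \<sigma> f1 f2 s) 0 < e"
    proof (cases "s \<le> \<sigma>")
      case False
      then have s': "\<sigma> < s" "s < b" using s by (auto simp: dist_real_def)
      have "\<sigma> * 1 \<le> s * f2 s" using s' b(2)[OF s'] assms(1) by (intro mult_mono) auto
      then have "\<bar>f1 s\<bar> / (s * f2 s) \<le> \<bar>f1 s\<bar> / \<sigma>" using assms(1) s' b(2)[OF s'] by (intro divide_left_mono mult_pos_pos) auto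
      also have "\<dots> < e" using d(2)[of s] s assms(1) by (simp add: divide_less_eq)
      finally show ?thesis using s' b(2)[OF s'] assms(1) by (simp add: afun_def dist_real_def abs_mult)
    qed (use e in \<open>simp add: afun_def\<close>)
  qed
qed

theorem theorem3p3:
  fixes \<Omega> :: "(real^'n) set"
    and \<alpha> \<sigma> :: real
    and f f1 f2 f3 :: "real \<Rightarrow> real"
    and fn fn1 fn2 fn3 :: "nat \<Rightarrow> real \<Rightarrow> real"
    and u :: "real^'n \<Rightarrow> real"
  assumes dim: "CARD('n) \<ge> 2"
    and dom: "open \<Omega>" "connected \<Omega>" "\<Omega> \<noteq> {}" "bounded \<Omega>"
    and alpha: "0 < \<alpha>" "\<alpha> < 1"
    and bdry: "C2alpha_boundary \<alpha> \<Omega>"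
    \<comment> \<open>standing assumptions (A) on f\<close>
    and sigma: "\<sigma> > 0"
    and f_convex: "convex_on {0..} f"
    and f_mono: "mono_on {0..} f"
    and f_C1: "\<And>s. s \<ge> 0 \<Longrightarrow> (f has_real_derivative f1 s) (at s within {0..})"
              "continuous_on {0..} f1"
    and f_C3: "\<And>s. s > \<sigma> \<Longrightarrow> (f1 has_real_derivative f2 s) (at s)"
              "\<And>s. s > \<sigma> \<Longrightarrow> (f2 has_real_derivative f3 s) (at s)"
              "continuous_on {\<sigma><..} f3"
    and f0: "f 0 = 0"
    and f_superlin: "filterlim (\<lambda>s. f s / s) at_top at_top"
    and f1_zero: "\<And>s. 0 \<le> s \<Longrightarrow> s \<le> \<sigma> \<Longrightarrow> f1 s = 0"
    and f2_pos: "\<And>s. s > \<sigma> \<Longrightarrow> f2 s > 0"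
    and f2_blowup: "filterlim f2 at_top (at_right \<sigma>)"
    \<comment> \<open>u is the minimizer of J over W^{1,infinity}_0\<close>
    and u_W: "u \<in> W1inf0 \<Omega>"
    and u_min: "\<And>v. v \<in> W1inf0 \<Omega> \<Longrightarrow> Jfun f \<Omega> u \<le> Jfun f \<Omega> v"
    \<comment> \<open>the approximating sequence f_n\<close>
    and fn_convex: "\<And>n. convex_on {0..} (fn n)"
    and fn0: "\<And>n. fn n 0 = 0"
    and fn_superlin: "\<And>n. filterlim (\<lambda>s. fn n s / s) at_top at_top"
    and fn_C1: "\<And>n s. s \<ge> 0 \<Longrightarrow> (fn n has_real_derivative fn1 n s) (at s within {0..})"
               "\<And>n. continuous_on {0..} (fn1 n)"
    and fn_C3: "\<And>n s. s > 0 \<Longrightarrow> (fn1 n has_real_derivative fn2 n s) (at s)"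
               "\<And>n s. s > 0 \<Longrightarrow> (fn2 n has_real_derivative fn3 n s) (at s)"
               "\<And>n. continuous_on {0<..} (fn3 n)"
    and fn_unif: "\<And>K. compact K \<Longrightarrow> K \<subseteq> {0..} \<Longrightarrow> uniform_limit K fn f sequentially"
    and fn1_0: "\<And>n. fn1 n 0 = 0"
    and fn1_decr: "\<And>n s. s \<ge> 0 \<Longrightarrow> fn1 (Suc n) s \<le> fn1 n s"
    and fn1_unif: "\<And>K. compact K \<Longrightarrow> K \<subseteq> {0..} \<Longrightarrow> uniform_limit K fn1 f1 sequentially"
    and fn2_pos: "\<And>n s. s > 0 \<Longrightarrow> fn2 n s > 0"
    and fn_v1: "\<And>n. ((\<lambda>s. (s * fn2 n s - fn1 n s) / s ^ 3) \<longlongrightarrow> 0) (at_right 0)"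
    and fn_v2: "\<And>n. ((\<lambda>s. fn1 n s / s) \<longlongrightarrow> 0) (at_right 0)"
    and fn_vi1: "\<And>K. compact K \<Longrightarrow> K \<subseteq> {0..<\<sigma>} \<Longrightarrow>
       uniform_limit K (\<lambda>n s. if s = 0 then 0 else (s * fn2 n s - fn1 n s) / s ^ 3) (\<lambda>s. 0) sequentially"
    and fn_vi2: "\<And>K. compact K \<Longrightarrow> K \<subseteq> {0..<\<sigma>} \<Longrightarrow>
       uniform_limit K (\<lambda>n s. if s = 0 then 0 else fn1 n s / s) (\<lambda>s. 0) sequentially"
    and an_unif: "\<And>K. compact K \<Longrightarrow> K \<subseteq> {0<..} \<Longrightarrow>
       uniform_limit K (\<lambda>n s. fn1 n s / (s * fn2 n s)) (afun \<sigma> f1 f2) sequentially"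
    and bn_unif: "\<And>K. compact K \<Longrightarrow> K \<subseteq> {\<sigma><..} \<Longrightarrow>
       uniform_limit K (\<lambda>n s. s ^ 2 / fn2 n s) (bfun \<sigma> f2) sequentially"
  shows "viscosity_solution \<Omega>
           (\<lambda>p X. min (- (1 - afun \<sigma> f1 f2 (norm p)) * inf_lap p X
                         - (norm p)^2 * afun \<sigma> f1 f2 (norm p) * trace X
                         - bfun \<sigma> f2 (norm p))
                        (norm p - \<sigma>)) u"
proof -
  let ?a = "afun \<sigma> f1 f2" and ?b = "bfun \<sigma> f2"
  let ?G = "\<lambda>p X. - (1 - ?a (norm p)) * inf_lap p X - (norm p)^2 * ?a (norm p) * trace X - ?b (norm p)"
  interpret energy \<Omega> f f1 \<sigma>
    using dom sigma f_convex f_mono f_C1 f0 f1_zero by unfold_locales auto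
  have f2_cont: "continuous_on {\<sigma><..} f2"
    using f_C3(2) by (intro continuous_at_imp_continuous_on) (auto intro: DERIV_isCont)
  have fn2_cont: "continuous_on {0<..} (fn2 n)" for n
    using fn_C3(2)[of _ n] by (intro continuous_at_imp_continuous_on) (auto intro: DERIV_isCont)
  have u_cont: "continuous_on \<Omega> u"
    using u_W by (auto simp: W1inf0_def intro: continuous_on_subset[OF lipschitz_on_continuous_on closure_subset])
  \<comment> \<open>Since b = s^2/f'', the prefactor from \<open>flux_div_eq\<close> turns b into
    the constant 1: \<open>?G\<close> < 0 says that the divergence exceeds -1, and \<open>?G\<close>
    > 0 that it is below -1.\<close>
  have flux: "flux_div f1 f2 p X = f2 (norm p) / (norm p)\<^sup>2 * (- ?G p X) - 1" if p: "\<sigma> < norm p" for p :: "real^'n" and X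
  proof -
    have "f2 (norm p) / (norm p)\<^sup>2 * ((norm p)\<^sup>2 / f2 (norm p)) = 1"
    proof -
      have "p \<noteq> 0" using p sigma by auto
      then show ?thesis using f2_pos[OF p] by simp
    qed
    then show ?thesis
      using p sigma f2_pos[OF p] by (subst flux_div_eq) (auto simp: afun_def bfun_def algebra_simps)
  qed
  have factor: "0 < f2 (norm p) / (norm p)\<^sup>2" if "\<sigma> < norm p" for p :: "real^'n"
    using f2_pos[OF that] that sigma by (intro divide_pos_pos zero_less_power) auto
  \<comment> \<open>A positive minimum forces |p| > \<sigma>, so contact from above meets only the
    regular case.\<close>
  have sub: "min (?G (D\<phi> x0) (D2\<phi> x0)) (norm (D\<phi> x0) - \<sigma>) \<le> 0"
    if x0: "x0 \<in> \<Omega>" and C2: "C2_on \<Omega> \<phi> D\<phi> D2\<phi>" and touch: "u x0 = \<phi> x0"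
      and above: "\<forall>x\<in>\<Omega>. x \<noteq> x0 \<longrightarrow> u x < \<phi> x" for x0 \<phi> D\<phi> D2\<phi>
  proof (rule ccontr)
    assume "\<not> ?thesis"
    then have G: "?G (D\<phi> x0) (D2\<phi> x0) > 0" and p: "\<sigma> < norm (D\<phi> x0)" by (auto simp: min_def split: if_splits)
    interpret contact \<Omega> f f1 \<sigma> "-1" "\<lambda>x. - u x" "\<lambda>x. - \<phi> x" "\<lambda>x. - D\<phi> x" "\<lambda>x. - D2\<phi> x" x0
    proof unfold_locales
      fix v assume "v \<in> W1inf0 \<Omega>"
      then have "Jfun f \<Omega> u \<le> Jfun f \<Omega> (\<lambda>x. - v x)" by (intro u_min W1inf0_uminus)
      then show "(LINT x:\<Omega>|lebesgue. f (norm (grad (\<lambda>x. - u x) x)) - (- 1) * (- u x))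
          \<le> (LINT x:\<Omega>|lebesgue. f (norm (grad v x)) - (- 1) * v x)"
        by (simp add: Jfun_def norm_grad_uminus)
    qed (use u_W C2 x0 touch above in \<open>auto intro: W1inf0_uminus C2_on_uminus\<close>)
    have "f2 (norm (D\<phi> x0)) / (norm (D\<phi> x0))\<^sup>2 * ?G (D\<phi> x0) (D2\<phi> x0) > 0"
      using factor[OF p] G by (rule mult_pos_pos)
    \<comment> \<open>The divergence is odd in (p, X), so for the reflected test function it exceeds
      1, which is - \<kappa>.\<close>
    then have "- (- 1) < flux_div f1 f2 (- D\<phi> x0) (- D2\<phi> x0)"
      unfolding flux_div_uminus flux[OF p] mult_minus_right by linarith
    then show False using p by (intro no_contact_regular[OF f_C3(1) f2_cont]) auto
  qed
  have super: "0 \<le> min (?G (D\<phi> x0) (D2\<phi> x0)) (norm (D\<phi> x0) - \<sigma>)"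
    if x0: "x0 \<in> \<Omega>" and C2: "C2_on \<Omega> \<phi> D\<phi> D2\<phi>" and touch: "u x0 = \<phi> x0"
      and below: "\<forall>x\<in>\<Omega>. x \<noteq> x0 \<longrightarrow> \<phi> x < u x" for x0 \<phi> D\<phi> D2\<phi>
  proof (rule ccontr)
    assume neg: "\<not> ?thesis"
    interpret contact \<Omega> f f1 \<sigma> 1 u \<phi> D\<phi> D2\<phi> x0
      using u_W C2 x0 touch below u_min by unfold_locales (auto simp: Jfun_def)
    consider "norm (D\<phi> x0) < \<sigma>" | "norm (D\<phi> x0) = \<sigma>" | "\<sigma> < norm (D\<phi> x0)" by linarith
    then show False
    proof cases
      case 1
      then show False by (rule no_contact_flat) simp
    next
      case 2
      \<comment> \<open>At |p| = \<sigma> both \<open>afun\<close> and \<open>bfun\<close> take the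
        value 0, so \<open>?G\<close> is minus the infinity Laplacian, while the other argument of
        the minimum is 0.\<close>
      then have "0 < inf_lap (D\<phi> x0) (D2\<phi> x0)" using neg by (auto simp: afun_def bfun_def min_def split: if_splits)
      then show False
        using 2 afun_tendsto_0[OF sigma f_C1(2) f1_zero f2_blowup] sigma
        by (intro no_contact_degenerate[OF _ _ _ fn_C3(1) fn2_cont fn2_pos fn1_unif an_unif]) auto
    next
      case 3
      then have "?G (D\<phi> x0) (D2\<phi> x0) < 0" using neg by (auto simp: min_def split: if_splits)
      then have "f2 (norm (D\<phi> x0)) / (norm (D\<phi> x0))\<^sup>2 * (- ?G (D\<phi> x0) (D2\<phi> x0)) > 0"
        using factor[OF 3] by (intro mult_pos_pos) auto
      then have "- 1 < flux_div f1 f2 (D\<phi> x0) (D2\<phi> x0)"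
        unfolding flux[OF 3] by linarith
      then show False using 3 by (intro no_contact_regular[OF f_C3(1) f2_cont]) auto
    qed
  qed
  have lim: "(u \<longlongrightarrow> u x) (at x within \<Omega>)" if "x \<in> \<Omega>" for x
    using u_cont that by (simp add: continuous_on_def)
  have usc: "usc_on \<Omega> u" and lsc: "lsc_on \<Omega> u"
    unfolding usc_on_def lsc_on_def using order_tendstoD[OF lim] by auto
  show ?thesis
    unfolding viscosity_solution_def viscosity_subsolution_def viscosity_supersolution_def
    using u_cont usc lsc sub super by blast
qed

end
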